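(* Let $(X,\sigma)$ and $(Y,\sigma)$ be non-degenerate rank-1 systems and let $\phi: X\to Y$ be a topological isomorphism. Then there is some $i\in\mathbb{Z}$ such that $\phi\circ\sigma^i : X\to Y$ is a stable isomorphism.
   Context: $\mathbb{N}$ includes $0$. $\mathcal{F}$ is the set of nonempty finite words over $\{0,1\}$ that begin and end with $0$. Juxtaposition denotes concatenation and $1^a$ is the word consisting of $a$ ones. An infinite word $V\in\{0,1\}^{\mathbb{N}}$ is built from $v\in\mathcal{F}$ if there is a sequence $(a_i)_{i\ge 1}$ of natural numbers with $V=v1^{a_1}v1^{a_2}v\cdots$. $V$ is rank-1 if it is built from infinitely many $v\in\mathcal{F}$. A rank-1 word $V$ is degenerate if $V=vvv\cdots$ for some finite word $v$, and non-degenerate otherwise. The rank-1 system associated to a rank-1 word $V$ is $(X,\sigma)$, where $X=\{x\in\{0,1\}^{\mathbb{Z}} : \text{every finite subword of } x \text{ is a subword of } V\}$ (with the subspace topology of the product topology) and $\sigma(x)(i)=x(i+1)$. A non-degenerate rank-1 system is the rank-1 system associated to a non-degenerate rank-1 word. A topological isomorphism from $(X,\sigma)$ to $(Y,\sigma)$ is a homeomorphism $\phi:X\to Y$ with $\phi\circ\sigma=\sigma\circ\phi$. For an element $x$ of a non-degenerate rank-1 system and $v\in\mathcal{F}$, $x$ is built from $v$ if there is a collection $E_v$ of occurrences of $v$ in $x$ such that each $0$ in $x$ is part of exactly one element of $E_v$ (such a collection is unique if it exists; it may be empty if $x$ has no $0$). If $x$ is built from $v$, an occurrence of $v$ in $x$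 is called expected if it belongs to $E_v$. An isomorphism $\phi:X\to Y$ between non-degenerate rank-1 systems is stable if there exist $v,w\in\mathcal{F}$ such that for all $x\in X$: (1) $x$ is built from $v$ and $\phi(x)$ is built from $w$; and (2) for every $k\in\mathbb{Z}$, $x$ has an expected occurrence of $v$ beginning at position $k$ iff $\phi(x)$ has an expected occurrence of $w$ beginning at position $k$. *)

theory Defs
  imports "HOL-Analysis.Analysis" "HOL-Library.Stream"
begin

text \<open>
  The symbols 0 and 1 are the Booleans False and True.  Finite words are lists, one-sided
  infinite words are streams, and two-sided infinite words are functions of type
  int => bool, on which the library topology is the product of the discrete topologies.
\<close>

definition words_F :: "bool list set" where
  "words_F = {v. v \<noteq> [] \<and> hd v = False \<and> last v = False}"

definition built_from :: "bool stream \<Rightarrow> bool list \<Rightarrow> bool" where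
  "built_from V v \<longleftrightarrow>
     (\<exists>a :: nat stream. V = flat (smap (\<lambda>n. v @ replicate n True) a))"

definition rank1_word :: "bool stream \<Rightarrow> bool" where
  "rank1_word V \<longleftrightarrow> infinite {v \<in> words_F. built_from V v}"

definition degenerate :: "bool stream \<Rightarrow> bool" where
  "degenerate V \<longleftrightarrow> (\<exists>v. v \<noteq> [] \<and> V = cycle v)"

definition subword :: "bool list \<Rightarrow> bool stream \<Rightarrow> bool" where
  "subword u V \<longleftrightarrow> (\<exists>n. stake (length u) (sdrop n V) = u)"

definition occurs_at :: "bool list \<Rightarrow> (int \<Rightarrow> bool) \<Rightarrow> int \<Rightarrow> bool" where
  "occurs_at u x k \<longleftrightarrow> (\<forall>j<length u. x (k + int j) = u ! j)"

definition rank1_system :: "bool stream \<Rightarrow> (int \<Rightarrow> bool) set" where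
  "rank1_system V = {x. \<forall>u k. occurs_at u x k \<longrightarrow> subword u V}"

definition nondegenerate_rank1_system :: "(int \<Rightarrow> bool) set \<Rightarrow> bool" where
  "nondegenerate_rank1_system X \<longleftrightarrow>
     (\<exists>V. rank1_word V \<and> \<not> degenerate V \<and> X = rank1_system V)"

definition shift :: "(int \<Rightarrow> bool) \<Rightarrow> int \<Rightarrow> bool" where
  "shift x = (\<lambda>i. x (i + 1))"

definition shift_power :: "int \<Rightarrow> (int \<Rightarrow> bool) \<Rightarrow> int \<Rightarrow> bool" where
  "shift_power i = (if 0 \<le> i then shift ^^ nat i else inv shift ^^ nat (- i))"

text \<open>
  A map between systems is a function on all two-sided words of which only the
  restriction to X matters.
\<close>

definition topological_isomorphism ::
    "(int \<Rightarrow> bool) set \<Rightarrow> (int \<Rightarrow> bool) set \<Rightarrow> ((int \<Rightarrow> bool) \<Rightarrow> int \<Rightarrow> bool) \<Rightarrow> bool" where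
  "topological_isomorphism X Y \<phi> \<longleftrightarrow>
     (\<exists>\<psi>. homeomorphism X Y \<phi> \<psi>) \<and> (\<forall>x\<in>X. \<phi> (shift x) = shift (\<phi> x))"

text \<open>
  A collection of occurrences of v in x is represented by the set E of their starting
  positions.
\<close>

definition covering_occurrences :: "bool list \<Rightarrow> (int \<Rightarrow> bool) \<Rightarrow> int set \<Rightarrow> bool" where
  "covering_occurrences v x E \<longleftrightarrow>
     (\<forall>k\<in>E. occurs_at v x k) \<and>
     (\<forall>i. x i = False \<longrightarrow> (\<exists>!k. k \<in> E \<and> k \<le> i \<and> i < k + int (length v)))"

definition biinf_built_from :: "(int \<Rightarrow> bool) \<Rightarrow> bool list \<Rightarrow> bool" where
  "biinf_built_from x v \<longleftrightarrow> (\<exists>E. covering_occurrences v x E)"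

text \<open>
  For v in words_F and x in a non-degenerate rank-1 system there is at most one such E, so
  the existential below speaks about the collection E.
\<close>

definition expected_at :: "bool list \<Rightarrow> (int \<Rightarrow> bool) \<Rightarrow> int \<Rightarrow> bool" where
  "expected_at v x k \<longleftrightarrow> (\<exists>E. covering_occurrences v x E \<and> k \<in> E)"

definition stable_isomorphism ::
    "(int \<Rightarrow> bool) set \<Rightarrow> (int \<Rightarrow> bool) set \<Rightarrow> ((int \<Rightarrow> bool) \<Rightarrow> int \<Rightarrow> bool) \<Rightarrow> bool" where
  "stable_isomorphism X Y \<phi> \<longleftrightarrow>
     topological_isomorphism X Y \<phi> \<and>
     (\<exists>v\<in>words_F. \<exists>w\<in>words_F. \<forall>x\<in>X.
        biinf_built_from x v \<and> biinf_built_from (\<phi> x) w \<and>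
        (\<forall>k. expected_at v x k \<longleftrightarrow> expected_at w (\<phi> x) k))"

lemma inv_shift: "inv shift x = (\<lambda>i. x (i - 1))"
proof (rule inv_f_eq)
  show "inj shift"
  proof (rule injI, rule ext)
    fix x y :: "int \<Rightarrow> bool" and i
    assume "shift x = shift y"
    then have "shift x (i - 1) = shift y (i - 1)" by simp
    then show "x i = y i" by (simp add: shift_def)
  qed
qed (simp add: shift_def)

lemma shift_power_apply: "shift_power i x n = x (n + i)"
proof -
  have pos: "(shift ^^ m) x n = x (n + int m)" for m x n
    by (induction m arbitrary: n) (auto simp: shift_def algebra_simps)
  have neg: "(inv shift ^^ m) x n = x (n - int m)" for m x n
    by (induction m arbitrary: n) (auto simp: inv_shift algebra_simps)
  show ?thesis by (simp add: shift_power_def pos neg)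
qed

end

theory Submission
  imports Defs
begin

text \<open>
  Fix w with W built from w and with more zeros than the coding window of \<phi> can blur at the two ends
  of a gap. Being an expected occurrence of w is a clopen condition, so for a long enough v and some s,
  every expected v at k in x forces an expected w at k + s in \<phi> x. This cuts \<phi> x into blocks
  w 1 ... 1 w ... w 1 ... 1, one for each expected v. All blocks have a long common prefix and a long
  common suffix, and what lies between contains fewer zeros than w. Counting zeros, all blocks contain
  the same number of copies of w, and any two blocks differ in the length of at most one run of ones,
  always at the same place. Starting the blocks just after that run instead yields a word U from which
  \<phi> x is built, with expected occurrences at a fixed distance from those of v in x.
\<close>

section \<open>Two-sided words and coverings\<close>

text \<open>The trouble lies around the ones between consecutive expected \<open>v\<close> in
  \<open>x\<close>. The length of this gap varies, and within distance \<open>r\<close> of its two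
  ends the coding window sees part of \<open>v\<close> together with ones, so nothing is known about
  \<open>\<phi> x\<close> there. Further inside, \<open>\<phi> x\<close> is all ones, since
  \<open>\<phi>\<close> fixes the constant word of ones. Hence the lengths of blocks are not
  controlled, but their zeros are: the unknown letters fill at most two stretches of length
  \<open>2 * r\<close>. This is why \<open>w\<close> is given more than \<open>4 * r\<close> zeros.
  If two gaps in a block could vary, the whole copy of \<open>w\<close> between them would have to
  fit into those stretches.

  Two more points shape the proof. \<open>expected_at\<close> is existential, so it can be handled
  only once coverings are known to be unique, which rests on non-degeneracy. And an element of the
  system may have no zeros at all, so that it has no blocks to count; the cutting is therefore done
  on the right half of a single point \<open>z\<close> that extends \<open>V\<close> and in which
  every finite pattern of the system recurs.\<close>

instance bool :: first_countable_topology
proof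
  fix x :: bool
  show "\<exists>A :: nat \<Rightarrow> bool set. (\<forall>i. x \<in> A i \<and> open (A i)) \<and>
      (\<forall>S. open S \<and> x \<in> S \<longrightarrow> (\<exists>i. A i \<subseteq> S))"
    by (rule exI[of _ "\<lambda>_. {x}"]) (simp add: open_discrete)
qed

lemma LIMSEQ_bool_fun_iff:
  fixes f :: "nat \<Rightarrow> int \<Rightarrow> bool"
  shows "f \<longlonglongrightarrow> l \<longleftrightarrow> (\<forall>i. \<forall>\<^sub>F n in sequentially. f n i = l i)"
proof -
  have "f \<longlonglongrightarrow> l \<longleftrightarrow> limitin (product_topology (\<lambda>i. euclidean) UNIV) f l sequentially"
    by (simp add: euclidean_product_topology)
  also have "\<dots> \<longleftrightarrow> (\<forall>i. (\<lambda>n. f n i) \<longlonglongrightarrow> l i)"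
    by (auto simp: limitin_componentwise)
  also have "\<dots> \<longleftrightarrow> (\<forall>i. \<forall>\<^sub>F n in sequentially. f n i = l i)"
    by (simp add: tendsto_discrete)
  finally show ?thesis .
qed

lemma bool_fun_convergent_subseq:
  fixes f :: "nat \<Rightarrow> int \<Rightarrow> bool"
  obtains l r where "strict_mono (r :: nat \<Rightarrow> nat)" "(f \<circ> r) \<longlonglongrightarrow> l"
proof -
  have "compact (UNIV :: bool set)" by (simp add: finite_imp_compact)
  then have "compact_space (product_topology (\<lambda>i::int. euclidean :: bool topology) UNIV)"
    unfolding compact_space_product_topology by (simp add: compact_space_def)
  then have "compact_space (euclidean :: (int \<Rightarrow> bool) topology)"
    by (simp add: euclidean_product_topology)
  then have "compact (UNIV :: (int \<Rightarrow> bool) set)"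
    by (simp add: compact_space_def)
  \<comment> \<open>Passing from covers to sequences needs first countability of
    \<open>int \<Rightarrow> bool\<close>, which comes from the instance for \<open>bool\<close>
    above.\<close>
  then have "seq_compact (UNIV :: (int \<Rightarrow> bool) set)"
    by (rule compact_imp_seq_compact)
  then show thesis
    by (rule seq_compactE[of UNIV f]) (use that in auto)
qed

lemma LIMSEQ_bool_fun_finite:
  fixes f :: "nat \<Rightarrow> int \<Rightarrow> bool"
  assumes "f \<longlonglongrightarrow> l" "finite I"
  shows "\<forall>\<^sub>F n in sequentially. \<forall>i\<in>I. f n i = l i"
  using assms by (simp add: eventually_ball_finite LIMSEQ_bool_fun_iff)

lemma LIMSEQ_bool_fun_window:
  fixes f :: "nat \<Rightarrow> int \<Rightarrow> bool"
  assumes "f \<longlonglongrightarrow> l"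
  shows "\<forall>\<^sub>F n in sequentially. \<forall>i. \<bar>i\<bar> \<le> M \<longrightarrow> f n i = l i"
proof -
  have "\<forall>\<^sub>F n in sequentially. \<forall>i\<in>{-M..M}. f n i = l i"
    by (rule LIMSEQ_bool_fun_finite[OF assms]) simp
  then show ?thesis by (rule eventually_mono) (simp add: abs_le_iff)
qed

lemma LIMSEQ_bool_fun_growing_windows:
  fixes f g :: "nat \<Rightarrow> int \<Rightarrow> bool"
  assumes "f \<longlonglongrightarrow> l" "\<And>n i. \<bar>i\<bar> \<le> int n \<Longrightarrow> f n i = g n i"
  shows "g \<longlonglongrightarrow> l"
  unfolding LIMSEQ_bool_fun_iff
proof
  fix i
  have "\<forall>\<^sub>F n in sequentially. f n i = l i" using assms(1) by (simp add: LIMSEQ_bool_fun_iff)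
  then show "\<forall>\<^sub>F n in sequentially. g n i = l i"
    using eventually_ge_at_top[of "nat \<bar>i\<bar>"] by eventually_elim (auto simp: assms(2)[symmetric])
qed

section \<open>Shifts, occurrences and coverings tested at one position\<close>

lemma shift_power_shift_power: "shift_power a (shift_power b x) = shift_power (a + b) x"
  by (rule ext) (simp add: shift_power_apply algebra_simps)

lemma shift_power_0: "shift_power 0 x = x"
  by (rule ext) (simp add: shift_power_apply)

lemma shift_eq_shift_power: "shift x = shift_power 1 x"
  by (rule ext) (simp add: shift_power_apply shift_def)

lemma occurs_at_shift_power: "occurs_at u (shift_power n x) k \<longleftrightarrow> occurs_at u x (k + n)"
  by (simp add: occurs_at_def shift_power_apply algebra_simps)

lemma occurs_at_LIMSEQ:
  assumes "f \<longlonglongrightarrow> l" "occurs_at u l k"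
  shows "\<forall>\<^sub>F n in sequentially. occurs_at u (f n) k"
proof -
  have "\<forall>\<^sub>F n in sequentially. \<forall>i\<in>{k..k + int (length u)}. f n i = l i"
    by (rule LIMSEQ_bool_fun_finite[OF assms(1)]) simp
  then show ?thesis
    by (rule eventually_mono) (use assms(2) in \<open>auto simp: occurs_at_def\<close>)
qed

lemma shift_power_rank1_system: "x \<in> rank1_system V \<Longrightarrow> shift_power n x \<in> rank1_system V"
  by (fastforce simp: rank1_system_def occurs_at_shift_power)

lemma rank1_system_LIMSEQ:
  assumes "f \<longlonglongrightarrow> l" "\<And>n. f n \<in> rank1_system V"
  shows "l \<in> rank1_system V"
  unfolding rank1_system_def
proof (intro CollectI allI impI)
  fix u k assume "occurs_at u l k"
  then have "\<forall>\<^sub>F n in sequentially. occurs_at u (f n) k" by (rule occurs_at_LIMSEQ[OF assms(1)])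
  then obtain n where "occurs_at u (f n) k" by (meson eventually_sequentially order_refl)
  then show "subword u V" using assms(2)[of n] by (auto simp: rank1_system_def)
qed

text \<open>The demands of \<open>covering_occurrences\<close> at a single position. They inspect
  only letters and starting positions within distance \<open>length v\<close> of \<open>i\<close>,
  so they can be moved between words, passed to limits and used on a half-line.\<close>

definition covers_at :: "bool list \<Rightarrow> (int \<Rightarrow> bool) \<Rightarrow> int set \<Rightarrow> int \<Rightarrow> bool" where
  "covers_at v x E i \<longleftrightarrow> (i \<in> E \<longrightarrow> occurs_at v x i) \<and>
     (\<not> x i \<longrightarrow> (\<exists>!k. k \<in> E \<and> k \<le> i \<and> i < k + int (length v)))"

lemma covering_occurrences_iff: "covering_occurrences v x E \<longleftrightarrow> (\<forall>i. covers_at v x E i)"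
  by (auto simp: covering_occurrences_def covers_at_def)

lemma covers_at_cong:
  assumes x: "\<And>l. \<bar>l\<bar> \<le> int (length v) \<Longrightarrow> x (i + l) = x' (i' + l)"
    and E: "\<And>l. \<bar>l\<bar> \<le> int (length v) \<Longrightarrow> i + l \<in> E \<longleftrightarrow> i' + l \<in> E'"
  shows "covers_at v x E i \<longleftrightarrow> covers_at v x' E' i'"
proof -
  have "occurs_at v x i \<longleftrightarrow> occurs_at v x' i'"
    using x by (auto simp: occurs_at_def)
  moreover have "x i = x' i'" "i \<in> E \<longleftrightarrow> i' \<in> E'" using x[of 0] E[of 0] by auto
  moreover have "(\<exists>!k. k \<in> E \<and> k \<le> i \<and> i < k + int (length v)) \<longleftrightarrow>
      (\<exists>!k. k \<in> E' \<and> k \<le> i' \<and> i' < k + int (length v))" (is "(\<exists>!k. ?P k) \<longleftrightarrow> (\<exists>!k. ?Q k)")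
  proof -
    have PQ: "?P k \<longleftrightarrow> ?Q (k - i + i')" for k using E[of "k - i"] by (auto simp: algebra_simps)
    have QP: "?Q k \<longleftrightarrow> ?P (k - i' + i)" for k by (subst PQ) (simp add: algebra_simps)
    show ?thesis
    proof
      assume "\<exists>!k. ?P k"
      then obtain k where k: "?P k" and u: "\<And>l. ?P l \<Longrightarrow> l = k" by blast
      show "\<exists>!k. ?Q k"
      proof (rule ex1I)
        show "?Q (k - i + i')" using k PQ by blast
        fix l assume "?Q l" then have "l - i' + i = k" using u QP by blast
        then show "l = k - i + i'" by simp
      qed
    next
      assume "\<exists>!k. ?Q k"
      then obtain k where k: "?Q k" and u: "\<And>l. ?Q l \<Longrightarrow> l = k" by blast
      show "\<exists>!k. ?P k"
      proof (rule ex1I)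
        show "?P (k - i' + i)" using k QP by blast
        fix l assume "?P l" then have "l - i + i' = k" using u PQ by blast
        then show "l = k - i' + i" by simp
      qed
    qed
  qed
  ultimately show ?thesis by (simp add: covers_at_def)
qed

lemma covering_occurrences_shift_power:
  "covering_occurrences v (shift_power n x) E \<longleftrightarrow> covering_occurrences v x ((+) n ` E)"
proof -
  have "covers_at v (shift_power n x) E i \<longleftrightarrow> covers_at v x ((+) n ` E) (i + n)" for i
    by (rule covers_at_cong) (auto simp: shift_power_apply algebra_simps image_iff)
  moreover have "(\<forall>i. covers_at v x ((+) n ` E) (i + n)) \<longleftrightarrow> (\<forall>i. covers_at v x ((+) n ` E) i)"
    by (metis diff_add_cancel)
  ultimately show ?thesis by (simp add: covering_occurrences_iff)
qed

lemma expected_at_shift_power: "expected_at v (shift_power n x) k \<longleftrightarrow> expected_at v x (k + n)"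
proof
  assume "expected_at v (shift_power n x) k"
  then show "expected_at v x (k + n)"
    by (auto simp: expected_at_def covering_occurrences_shift_power)
next
  assume "expected_at v x (k + n)"
  then obtain E where E: "covering_occurrences v x E" "k + n \<in> E" by (auto simp: expected_at_def)
  have "(+) n ` ((+) (- n) ` E) = E" by (auto simp: image_iff)
  then have "covering_occurrences v (shift_power n x) ((+) (- n) ` E)"
    using E(1) by (simp add: covering_occurrences_shift_power)
  moreover have "k \<in> (+) (- n) ` E" using E(2) by (force simp: image_iff)
  ultimately show "expected_at v (shift_power n x) k" by (auto simp: expected_at_def)
qed

text \<open>Coverings are themselves treated as points of the compact space
  \<open>int \<Rightarrow> bool\<close>. At each position the covering condition reads a finite
  window, on which the sequences are eventually constant.\<close>

lemma covering_occurrences_LIMSEQ: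
  assumes x: "f \<longlonglongrightarrow> x" and e: "e \<longlonglongrightarrow> E"
    and cov: "\<And>i. \<forall>\<^sub>F n in sequentially. covers_at v (f n) {k. e n k} i"
  shows "covering_occurrences v x {k. E k}"
  unfolding covering_occurrences_iff
proof
  fix i
  let ?I = "{i - int (length v)..i + int (length v)}"
  have "\<forall>\<^sub>F n in sequentially. \<forall>k\<in>?I. f n k = x k" "\<forall>\<^sub>F n in sequentially. \<forall>k\<in>?I. e n k = E k"
    using x e by (auto intro!: LIMSEQ_bool_fun_finite)
  with cov[of i] have "\<forall>\<^sub>F n in sequentially. covers_at v x {k. E k} i"
  proof eventually_elim
    case (elim n)
    have "covers_at v (f n) {k. e n k} i \<longleftrightarrow> covers_at v x {k. E k} i"
      using elim(2,3) by (intro covers_at_cong) (simp_all add: abs_le_iff)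
    then show ?case using elim(1) by simp
  qed
  then show "covers_at v x {k. E k} i" by simp
qed

text \<open>The half-line form of a covering, used both for \<open>V\<close> cut into copies of
  \<open>v\<close> and for the final copies of \<open>U\<close>.\<close>

lemma covers_at_range:
  fixes f :: "nat \<Rightarrow> int"
  assumes step: "\<And>n. f n + int (length v) \<le> f (Suc n)"
    and occ: "\<And>n. occurs_at v x (f n)"
    and ones: "\<And>n j. f n + int (length v) \<le> j \<Longrightarrow> j < f (Suc n) \<Longrightarrow> x j"
    and v: "v \<noteq> []" and i: "f 0 \<le> i"
  shows "covers_at v x (range f) i"
proof -
  have mono: "f m + int (length v) \<le> f n" if "m < n" for m n
    using that
  proof (induction n)
    case (Suc n)
    then show ?case using step[of n] step[of m] by (cases "m = n") auto
  qed simp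
  have ge: "f 0 + int n \<le> f n" for n
  proof (induction n)
    case (Suc n)
    then show ?case using step[of n] v by (cases v) auto
  qed simp
  have "\<exists>!k. k \<in> range f \<and> k \<le> i \<and> i < k + int (length v)" if z: "\<not> x i"
  proof -
    \<comment> \<open>The last index with \<open>f n \<le> i\<close>: the only occurrence that can
      contain \<open>i\<close>.\<close>
    define n where "n = (LEAST n. i < f (Suc n))"
    have "i < f (Suc (nat (i - f 0)))" using ge[of "Suc (nat (i - f 0))"] i by simp
    then have n: "i < f (Suc n)" unfolding n_def by (rule LeastI)
    have le: "f n \<le> i"
    proof (cases n)
      case (Suc n')
      then have "\<not> i < f (Suc n')" using not_less_Least[of n' "\<lambda>n. i < f (Suc n)"] by (simp add: n_def)
      then show ?thesis using Suc by simp
    qed (use i in simp)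
    have lt: "i < f n + int (length v)" using ones[of n i] z n by force
    show ?thesis
    proof (rule ex1I[of _ "f n"])
      show "f n \<in> range f \<and> f n \<le> i \<and> i < f n + int (length v)" using le lt by simp
      fix k assume "k \<in> range f \<and> k \<le> i \<and> i < k + int (length v)"
      then obtain m where m: "k = f m" "f m \<le> i" "i < f m + int (length v)" by auto
      then have "m = n" using mono[of m n] mono[of n m] le lt by (cases m n rule: linorder_cases) auto
      then show "k = f n" using m by simp
    qed
  qed
  then show ?thesis using occ by (auto simp: covers_at_def)
qed

section \<open>Rank-1 words and their systems\<close>

lemma built_from_blocks:
  assumes "built_from V v" "v \<noteq> []"
  obtains P :: "nat \<Rightarrow> nat" where "P 0 = 0" "\<And>n. P n + length v \<le> P (Suc n)"
    "\<And>n j. j < length v \<Longrightarrow> V !! (P n + j) = v ! j"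
    "\<And>n j. P n + length v \<le> j \<Longrightarrow> j < P (Suc n) \<Longrightarrow> V !! j"
proof -
  obtain a :: "nat stream" where V: "V = flat (smap (\<lambda>n. v @ replicate n True) a)"
    using assms(1) by (auto simp: built_from_def)
  define P where "P n = (\<Sum>t<n. length v + a !! t)" for n
  let ?W = "\<lambda>n. v @ replicate n True"
  have unfold: "flat (smap ?W (sdrop n a)) = ?W (a !! n) @- flat (smap ?W (sdrop (Suc n) a))" for n
    using flat_unfold[of "smap ?W (sdrop n a)"] assms(2)
    by (simp del: sdrop.simps)
  have drop: "sdrop (P n) V = flat (smap ?W (sdrop n a))" for n
  proof (induction n)
    case (Suc n)
    have "sdrop (P (Suc n)) V = sdrop (length v + a !! n) (sdrop (P n) V)"
      by (simp add: P_def add.commute del: sdrop.simps)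
    also have "\<dots> = flat (smap ?W (sdrop (Suc n) a))"
      unfolding Suc.IH by (subst unfold) (simp add: sdrop_shift del: sdrop.simps(2))
    finally show ?case .
  qed (simp add: P_def V)
  have nth: "V !! (P n + j) = ?W (a !! n) ! j" if "j < length v + a !! n" for n j
  proof -
    have "V !! (P n + j) = sdrop (P n) V !! j" by (rule sdrop_snth[symmetric])
    also have "\<dots> = flat (smap ?W (sdrop n a)) !! j" by (simp only: drop)
    also have "\<dots> = (?W (a !! n) @- flat (smap ?W (sdrop (Suc n) a))) !! j"
      by (subst unfold) (rule refl)
    also have "\<dots> = ?W (a !! n) ! j" by (rule shift_snth_less) (simp add: that)
    finally show ?thesis .
  qed
  show thesis
  proof
    show "P 0 = 0" "P n + length v \<le> P (Suc n)" for n by (auto simp: P_def)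
    show "V !! (P n + j) = v ! j" if "j < length v" for n j
      using nth[of j n] that by (simp add: nth_append)
    show "V !! j" if "P n + length v \<le> j" "j < P (Suc n)" for n j
      using nth[of "j - P n" n] that by (auto simp: P_def nth_append)
  qed
qed

text \<open>The word V preceded by ones, so that its coverings are coverings of a two-sided word.\<close>

definition ones_before :: "bool stream \<Rightarrow> int \<Rightarrow> bool" where
  "ones_before V i \<longleftrightarrow> i < 0 \<or> V !! nat i"

lemma ones_before_covering:
  assumes "built_from V v" "v \<in> words_F"
  shows "\<exists>E. covering_occurrences v (ones_before V) E"
proof -
  have v: "v \<noteq> []" using assms(2) by (simp add: words_F_def)
  obtain P where P: "P 0 = 0" "\<And>n. P n + length v \<le> P (Suc n)"
    "\<And>n j. j < length v \<Longrightarrow> V !! (P n + j) = v ! j"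
    "\<And>n j. P n + length v \<le> j \<Longrightarrow> j < P (Suc n) \<Longrightarrow> V !! j"
    using built_from_blocks[OF assms(1) v] by metis
  have "covers_at v (ones_before V) (range (\<lambda>n. int (P n))) i" for i
  proof (cases "0 \<le> i")
    case True
    show ?thesis
    proof (rule covers_at_range)
      show "int (P n) + int (length v) \<le> int (P (Suc n))" for n using P(2)[of n] by linarith
      show "occurs_at v (ones_before V) (int (P n))" for n
        using P(3) by (auto simp: occurs_at_def ones_before_def nat_add_distrib)
      show "ones_before V j" if "int (P n) + int (length v) \<le> j" "j < int (P (Suc n))" for n j
        using P(4)[of n "nat j"] that by (auto simp: ones_before_def)
    qed (use v True P(1) in auto)
  qed (auto simp: covers_at_def ones_before_def)
  then show ?thesis unfolding covering_occurrences_iff by blast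
qed

text \<open>It is enough to test central windows. The bound \<open>m \<ge> int n\<close> keeps the
  window of radius \<open>n\<close> around \<open>m\<close> inside \<open>V\<close> itself, away
  from the artificial ones.\<close>

lemma rank1_system_iff:
  "x \<in> rank1_system V \<longleftrightarrow> (\<forall>n. \<exists>m\<ge>int n. \<forall>i. \<bar>i\<bar> \<le> int n \<longrightarrow> x i = ones_before V (m + i))"
proof
  assume x: "x \<in> rank1_system V"
  show "\<forall>n. \<exists>m\<ge>int n. \<forall>i. \<bar>i\<bar> \<le> int n \<longrightarrow> x i = ones_before V (m + i)"
  proof
    fix n
    define u where "u = map (\<lambda>j. x (- int n + int j)) [0..<2 * n + 1]"
    have len: "length u = 2 * n + 1" by (simp add: u_def)
    have "occurs_at u x (- int n)" by (auto simp: occurs_at_def u_def simp del: upt_Suc)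
    then have "subword u V" using x by (auto simp: rank1_system_def)
    then obtain N where N: "stake (length u) (sdrop N V) = u" by (auto simp: subword_def)
    have nth: "V !! (N + j) = x (- int n + int j)" if "j < 2 * n + 1" for j
    proof -
      have "V !! (N + j) = stake (length u) (sdrop N V) ! j" using that len by (simp add: sdrop_snth del: stake.simps)
      also have "\<dots> = x (- int n + int j)" unfolding N using that by (simp add: u_def del: upt_Suc)
      finally show ?thesis .
    qed
    have "x i = ones_before V (int (N + n) + i)" if "\<bar>i\<bar> \<le> int n" for i
    proof -
      have "nat (int (N + n) + i) = N + nat (int n + i)" using that by linarith
      then show ?thesis using nth[of "nat (int n + i)"] that by (auto simp: ones_before_def)
    qed
    then show "\<exists>m\<ge>int n. \<forall>i. \<bar>i\<bar> \<le> int n \<longrightarrow> x i = ones_before V (m + i)"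
      by (intro exI[of _ "int (N + n)"]) auto
  qed
next
  assume R: "\<forall>n. \<exists>m\<ge>int n. \<forall>i. \<bar>i\<bar> \<le> int n \<longrightarrow> x i = ones_before V (m + i)"
  show "x \<in> rank1_system V"
    unfolding rank1_system_def
  proof (intro CollectI allI impI)
    fix u k assume occ: "occurs_at u x k"
    define n where "n = nat \<bar>k\<bar> + length u"
    obtain m where m: "m \<ge> int n" "\<And>i. \<bar>i\<bar> \<le> int n \<Longrightarrow> x i = ones_before V (m + i)"
      using R by meson
    have "V !! (nat (m + k) + j) = u ! j" if "j < length u" for j
    proof -
      have "nat (m + k) + j = nat (m + (k + int j))" "\<bar>k + int j\<bar> \<le> int n" "0 \<le> m + (k + int j)"
        using m(1) that by (auto simp: n_def)
      then show ?thesis using m(2)[of "k + int j"] occ that by (auto simp: ones_before_def occurs_at_def)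
    qed
    then have "stake (length u) (sdrop (nat (m + k)) V) = u"
      by (intro nth_equalityI) (auto simp: sdrop_snth)
    then show "subword u V" by (auto simp: subword_def)
  qed
qed

text \<open>Larger and larger windows of \<open>x\<close> are seen in \<open>V\<close>, at the
  positions \<open>m n\<close>. The covering of \<open>V\<close> translated by \<open>m n\<close>
  has a convergent subsequence by compactness, and its limit covers \<open>x\<close>.\<close>

lemma biinf_built_from_rank1_system:
  assumes "x \<in> rank1_system V" "built_from V v" "v \<in> words_F"
  shows "biinf_built_from x v"
proof -
  obtain E0 where E0: "covering_occurrences v (ones_before V) E0"
    using ones_before_covering assms(2,3) by blast
  obtain m where m: "\<And>n i. \<bar>i\<bar> \<le> int n \<Longrightarrow> x i = ones_before V (m n + i)"
    using assms(1) unfolding rank1_system_iff by metis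
  define f where "f n = shift_power (m n) (ones_before V)" for n
  define e where "e n k \<longleftrightarrow> k + m n \<in> E0" for n k
  have "(\<lambda>n. x) \<longlonglongrightarrow> x" by simp
  then have f: "f \<longlonglongrightarrow> x"
    by (rule LIMSEQ_bool_fun_growing_windows) (simp add: m f_def shift_power_apply algebra_simps)
  have cov: "covering_occurrences v (f n) {k. e n k}" for n
  proof -
    have "(+) (m n) ` {k. e n k} = E0"
      by (force simp: e_def image_iff algebra_simps intro: exI[of _ "_ - m n"])
    then show ?thesis using E0 by (simp add: f_def covering_occurrences_shift_power)
  qed
  obtain r E where r: "strict_mono (r :: nat \<Rightarrow> nat)" "(e \<circ> r) \<longlonglongrightarrow> E"
    by (rule bool_fun_convergent_subseq)
  have "covering_occurrences v x {k. E k}"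
  proof (rule covering_occurrences_LIMSEQ)
    show "(f \<circ> r) \<longlonglongrightarrow> x" by (rule LIMSEQ_subseq_LIMSEQ[OF f r(1)])
    show "\<forall>\<^sub>F n in sequentially. covers_at v ((f \<circ> r) n) {k. (e \<circ> r) n k} i" for i
      using cov by (simp add: covering_occurrences_iff)
  qed (rule r(2))
  then show ?thesis by (auto simp: biinf_built_from_def)
qed

lemma built_from_prefix:
  assumes "built_from V v" "v \<noteq> []" "j < length v"
  shows "V !! j = v ! j"
proof -
  obtain P where P: "P 0 = 0" "\<And>n. P n + length v \<le> P (Suc n)"
    "\<And>n j. j < length v \<Longrightarrow> V !! (P n + j) = v ! j"
    using built_from_blocks[OF assms(1,2)] by metis
  from P(1) P(3)[of j 0] show ?thesis using assms(3) by simp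
qed

lemma rank1_word_long:
  assumes "rank1_word V"
  obtains v where "v \<in> words_F" "built_from V v" "n < length v"
proof -
  have "finite {v :: bool list. length v \<le> n}"
    using finite_lists_length_le[of "UNIV :: bool set" n] by simp
  then have "\<not> {v \<in> words_F. built_from V v} \<subseteq> {v. length v \<le> n}"
    using assms finite_subset by (auto simp: rank1_word_def)
  then show thesis using that by force
qed

lemma rank1_word_starts_False:
  assumes "rank1_word V"
  shows "\<not> V !! 0"
proof -
  obtain v where v: "v \<in> words_F" "built_from V v" "0 < length v"
    using rank1_word_long[OF assms] by metis
  then show ?thesis using built_from_prefix[of V v 0] by (auto simp: words_F_def hd_conv_nth)
qed

text \<open>Any prefix of \<open>V\<close> is a prefix of some longer \<open>v\<close> from which
  \<open>V\<close> is built, and \<open>v\<close> recurs arbitrarily far out.\<close>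

lemma rank1_word_recurrence:
  assumes "rank1_word V"
  obtains N' where "N' \<ge> N" "\<And>j. j < n \<Longrightarrow> V !! (N' + j) = V !! j"
proof -
  obtain v where v: "v \<in> words_F" "built_from V v" "n < length v"
    using rank1_word_long[OF assms] by metis
  then have ne: "v \<noteq> []" by auto
  obtain P where P: "P 0 = 0" "\<And>n. P n + length v \<le> P (Suc n)"
    "\<And>n j. j < length v \<Longrightarrow> V !! (P n + j) = v ! j"
    using built_from_blocks[OF v(2) ne] by metis
  have "t \<le> P t" for t
  proof (induction t)
    case (Suc t)
    then show ?case using P(2)[of t] ne by (cases v) auto
  qed simp
  then show thesis
    using that[of "P N"] P(3) v(3) built_from_prefix[OF v(2) ne] by auto
qed

text \<open>The left half of \<open>z\<close> is a limit of what stands to the left of later and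
  later recurrences of prefixes of \<open>V\<close>. Every window of an \<open>x\<close> in the
  system lies in some prefix of \<open>V\<close>, and that prefix recurs arbitrarily far to the
  right.\<close>

lemma rank1_system_transitive_point:
  assumes "rank1_word V"
  obtains z where "z \<in> rank1_system V" "\<And>n. z (int n) = V !! n"
    "\<And>x M N. x \<in> rank1_system V \<Longrightarrow> \<exists>n\<ge>N. \<forall>i. \<bar>i\<bar> \<le> M \<longrightarrow> x i = z (n + i)"
proof -
  have "\<exists>N'\<ge>n. \<forall>j<n. V !! (N' + j) = V !! j" for n using rank1_word_recurrence[OF assms] by metis
  then obtain N' where N': "\<And>n. N' n \<ge> n" "\<And>n j. j < n \<Longrightarrow> V !! (N' n + j) = V !! j" by metis
  define f where "f n = shift_power (int (N' n)) (ones_before V)" for n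
  obtain r z where r: "strict_mono (r :: nat \<Rightarrow> nat)" and fz: "(f \<circ> r) \<longlonglongrightarrow> z"
    by (rule bool_fun_convergent_subseq)
  have z: "z (int n) = V !! n" for n
  proof -
    have "\<forall>\<^sub>F t in sequentially. (f \<circ> r) t (int n) = z (int n)"
      using fz by (simp add: LIMSEQ_bool_fun_iff)
    then have "\<forall>\<^sub>F t in sequentially. V !! n = z (int n)"
      using eventually_gt_at_top[of n]
    proof eventually_elim
      case (elim t)
      then have "n < r t" using seq_suble[OF r, of t] by simp
      then have "V !! (N' (r t) + n) = V !! n" using N'(2) by blast
      then show ?case
        using elim(1) by (auto simp: f_def shift_power_apply ones_before_def nat_add_distrib add.commute)
    qed
    then show ?thesis by simp
  qed
  have mem: "z \<in> rank1_system V"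
    unfolding rank1_system_iff
  proof
    fix n
    have "\<forall>\<^sub>F t in sequentially. \<forall>i. \<bar>i\<bar> \<le> int n \<longrightarrow> (f \<circ> r) t i = z i"
      by (rule LIMSEQ_bool_fun_window[OF fz])
    then have "\<forall>\<^sub>F t in sequentially. t \<ge> n \<and> (\<forall>i. \<bar>i\<bar> \<le> int n \<longrightarrow> (f \<circ> r) t i = z i)"
      using eventually_ge_at_top[of n] by eventually_elim auto
    then obtain t where t: "t \<ge> n" "\<And>i. \<bar>i\<bar> \<le> int n \<Longrightarrow> (f \<circ> r) t i = z i"
      using eventually_happens'[OF sequentially_bot] by blast
    have "int n \<le> int (N' (r t))" using N'(1)[of "r t"] seq_suble[OF r, of t] t(1) by linarith
    then show "\<exists>m\<ge>int n. \<forall>i. \<bar>i\<bar> \<le> int n \<longrightarrow> z i = ones_before V (m + i)"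
      using t(2) by (intro exI[of _ "int (N' (r t))"]) (auto simp: f_def shift_power_apply add.commute)
  qed
  have "\<exists>n\<ge>N. \<forall>i. \<bar>i\<bar> \<le> M \<longrightarrow> x i = z (n + i)" if x: "x \<in> rank1_system V" for x M N
  proof -
    obtain m where m: "m \<ge> int (nat M)"
      "\<And>i. \<bar>i\<bar> \<le> int (nat M) \<Longrightarrow> x i = ones_before V (m + i)"
      using x unfolding rank1_system_iff by meson
    obtain N' where N': "N' \<ge> nat N" "\<And>j. j < nat (m + M + 1) \<Longrightarrow> V !! (N' + j) = V !! j"
      using rank1_word_recurrence[OF assms] by metis
    have "x i = z (int N' + m + i)" if i: "\<bar>i\<bar> \<le> M" for i
    proof -
      have "0 \<le> m + i" using m(1) i by linarith
      then have "int N' + m + i = int (N' + nat (m + i))" by simp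
      then have "z (int N' + m + i) = V !! (N' + nat (m + i))" by (simp only: z)
      also have "\<dots> = V !! nat (m + i)"
        using \<open>0 \<le> m + i\<close> i by (intro N'(2)) linarith
      finally have "z (int N' + m + i) = V !! nat (m + i)" .
      moreover have "\<bar>i\<bar> \<le> int (nat M)" using i by linarith
      then have "x i = ones_before V (m + i)" by (rule m(2))
      ultimately show ?thesis using \<open>0 \<le> m + i\<close> unfolding ones_before_def by (metis not_less)
    qed
    moreover have "int N' + m \<ge> N" using N'(1) m(1) by linarith
    ultimately show ?thesis by blast
  qed
  with mem z show thesis by (rule that)
qed

lemma stream_periodic_imp_degenerate:
  assumes "0 < p" "\<And>n. V !! (n + p) = V !! n"
  shows "degenerate V"
proof -
  define u where "u = stake p V"
  have u: "u \<noteq> []" "length u = p" using assms(1) by (auto simp: u_def)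
  have "V !! n = cycle u !! n" for n
  proof (induction n rule: less_induct)
    case (less n)
    have cyc: "cycle u !! n = (u @- cycle u) !! n" using cycle_decomp[OF u(1)] by simp
    show ?case
    proof (cases "n < p")
      case True
      then show ?thesis using cyc u by (simp add: shift_snth u_def)
    next
      case False
      then show ?thesis using cyc u less.IH[of "n - p"] assms(1) assms(2)[of "n - p"]
        by (simp add: shift_snth)
    qed
  qed
  then have "V = cycle u" using smap_alt[of id V "cycle u"] by (simp add: stream.map_id)
  then show ?thesis using u(1) by (auto simp: degenerate_def)
qed

text \<open>A zero far to the right lies in an expected \<open>v\<close>, and \<open>v\<close> can
  be chosen as long as desired. Hence every prefix of \<open>V\<close> occurs in the periodic part
  of \<open>x\<close>, and \<open>V\<close> inherits the period.\<close>

lemma eventually_periodic_imp_degenerate: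
  assumes V: "rank1_word V" and x: "x \<in> rank1_system V"
    and p: "0 < p" "\<And>i. k \<le> i \<Longrightarrow> x (i + int p) = x i"
    and zeros: "\<And>i. \<exists>j\<ge>i. \<not> x j"
  shows "degenerate V"
proof (rule stream_periodic_imp_degenerate[OF p(1)])
  fix n
  obtain v where v: "v \<in> words_F" "built_from V v" "n + p < length v"
    using rank1_word_long[OF V] by metis
  then have ne: "v \<noteq> []" by auto
  obtain E where E: "covering_occurrences v x E"
    using biinf_built_from_rank1_system[OF x v(2,1)] by (auto simp: biinf_built_from_def)
  obtain j where j: "j \<ge> k + int (length v)" "\<not> x j" using zeros by blast
  then obtain l where l: "l \<in> E" "l \<le> j" "j < l + int (length v)"
    using E unfolding covering_occurrences_def by blast
  have occ: "occurs_at v x l" and lk: "k \<le> l"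
    using E l j by (auto simp: covering_occurrences_def)
  have "V !! (n + p) = x (l + int (n + p))" "V !! n = x (l + int n)"
    using built_from_prefix[OF v(2) ne] v(3) occ by (auto simp: occurs_at_def)
  then show "V !! (n + p) = V !! n" using p(2)[of "l + int n"] lk by (simp add: algebra_simps)
qed

section \<open>Uniqueness of coverings\<close>

lemma expected_in_F:
  assumes "covering_occurrences v x E" "v \<in> words_F" "k \<in> E"
  shows "occurs_at v x k" "\<not> x k" "\<not> x (k + int (length v) - 1)"
proof -
  show occ: "occurs_at v x k" using assms by (simp add: covering_occurrences_def)
  have v: "v \<noteq> []" "\<not> v ! 0" "\<not> v ! (length v - 1)"
    using assms(2) by (auto simp: words_F_def hd_conv_nth last_conv_nth)
  then have "0 < length v" by simp
  then show "\<not> x k" using occ v(2) by (auto simp: occurs_at_def dest!: spec[of _ 0])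
  have "k + int (length v) - 1 = k + int (length v - 1)" using v(1) by (cases v) auto
  then show "\<not> x (k + int (length v) - 1)"
    using occ v(3) \<open>0 < length v\<close> unfolding occurs_at_def by (metis diff_less zero_less_one)
qed

text \<open>Otherwise the zero with which the second occurrence begins would belong to both.\<close>

lemma covering_separated:
  assumes "covering_occurrences v x E" "v \<in> words_F" "k \<in> E" "l \<in> E" "k < l"
  shows "k + int (length v) \<le> l"
proof (rule ccontr)
  assume "\<not> ?thesis"
  moreover have "\<not> x l" using expected_in_F assms by blast
  moreover have "v \<noteq> []" using assms(2) by (simp add: words_F_def)
  ultimately have "k = l"
    using assms unfolding covering_occurrences_def by (metis less_add_same_cancel1 length_greater_0_conv less_imp_le not_le of_nat_0_less_iff order_refl)
  then show False using assms(5) by simp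
qed

lemma covering_next:
  assumes cov: "covering_occurrences v x E" and v: "v \<in> words_F" and k: "k \<in> E"
    and i: "k + int (length v) \<le> i" "\<not> x i"
    and ones: "\<And>j. k + int (length v) \<le> j \<Longrightarrow> j < i \<Longrightarrow> x j"
  shows "i \<in> E"
proof -
  obtain l where l: "l \<in> E" "l \<le> i" "i < l + int (length v)"
    using cov i(2) unfolding covering_occurrences_def by blast
  have "k < l" using l(3) i(1) by linarith
  then have "k + int (length v) \<le> l" using covering_separated[OF cov v k l(1)] by simp
  then have "l = i" using ones[of l] expected_in_F(2)[OF cov v l(1)] l(2) by force
  then show ?thesis using l(1) by simp
qed

locale nondegenerate_rank1 =
  fixes V :: "bool stream"
  assumes rank1: "rank1_word V" and nondegenerate: "\<not> degenerate V"
begin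

text \<open>If two coverings differ, each of them has an occurrence that overlaps one of the other. The
  overlap determines where the next occurrence of the first covering starts, hence the next overlap.
  The sequence of overlaps is eventually periodic, and so is x.\<close>

lemma covering_subset:
  assumes x: "x \<in> rank1_system V" and v: "v \<in> words_F"
    and E: "covering_occurrences v x E" and E': "covering_occurrences v x E'"
  shows "E \<subseteq> E'"
proof (rule ccontr)
  assume "\<not> E \<subseteq> E'"
  then obtain k where k: "k \<in> E" "k \<notin> E'" by blast
  have ne: "v \<noteq> []" and last: "\<not> v ! (length v - 1)" using v by (auto simp: words_F_def last_conv_nth)
  have "\<not> x k" using expected_in_F(2)[OF E v k(1)] .
  then obtain k' where k': "k' \<in> E'" "k' \<le> k" "k < k' + int (length v)"
    using E' unfolding covering_occurrences_def by blast
  then have "k' < k" using k(2) by (cases "k = k'") auto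
  \<comment> \<open>Overlapping occurrences, one from each covering; which covering comes first is
    left open, because the roles alternate from one overlap to the next.\<close>
  define Q where "Q a b \<longleftrightarrow> (a \<in> E' \<and> b \<in> E \<or> a \<in> E \<and> b \<in> E') \<and> a < b \<and> b < a + int (length v)" for a b
  \<comment> \<open>If the second occurrence starts \<open>d\<close> after the first,
    \<open>g d\<close> is the offset in the second of its first zero beyond the end of the first.
    The covering that owns the first occurrence must start its next one exactly there. Such a zero
    exists because \<open>v\<close> ends with one.\<close>
  define g where "g d = (LEAST m. length v \<le> m + d \<and> \<not> v ! m)" for d
  have step: "Q b (b + int (g (nat (b - a))))" if Qab: "Q a b" for a b
  proof -
    obtain A B where AB: "a \<in> A" "b \<in> B" "covering_occurrences v x A" "covering_occurrences v x B"
      "A = E' \<and> B = E \<or> A = E \<and> B = E'"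
      using Qab E E' unfolding Q_def by blast
    have ab: "a < b" "b < a + int (length v)" using Qab by (auto simp: Q_def)
    define d where "d = nat (b - a)"
    have d: "0 < d" "b = a + int d" using ab by (auto simp: d_def)
    have w: "length v \<le> (length v - 1) + d \<and> \<not> v ! (length v - 1)" using d(1) last by auto
    have g: "length v \<le> g d + d" "\<not> v ! g d"
      using LeastI[of "\<lambda>m. length v \<le> m + d \<and> \<not> v ! m", OF w] by (auto simp: g_def)
    have "g d \<le> length v - 1"
      unfolding g_def by (rule Least_le[of "\<lambda>m. length v \<le> m + d \<and> \<not> v ! m", OF w])
    then have gl: "g d < length v" using ne by (cases v) auto
    have occ: "occurs_at v x b" using AB by (simp add: covering_occurrences_def)
    have "b + int (g d) \<in> A"
    proof (rule covering_next[OF AB(3) v AB(1)])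
      show "a + int (length v) \<le> b + int (g d)" using g(1) d(2) by linarith
      show "\<not> x (b + int (g d))" using occ gl g(2) by (simp add: occurs_at_def)
      show "x j" if j: "a + int (length v) \<le> j" "j < b + int (g d)" for j
      proof -
        define m where "m = nat (j - b)"
        have m: "j = b + int m" "m < g d" using j ab by (auto simp: m_def)
        have "length v \<le> m + d" using j(1) m(1) d(2) by linarith
        then have "v ! m" using not_less_Least[of m "\<lambda>m. length v \<le> m + d \<and> \<not> v ! m"] m(2)
          by (auto simp: g_def)
        then show ?thesis using occ m gl by (simp add: occurs_at_def)
      qed
    qed
    moreover have "0 < g d" using g(1) ab d by linarith
    ultimately show ?thesis using AB gl unfolding Q_def d_def by auto
  qed
  define d where "d n = (g ^^ n) (nat (k - k'))" for n
  define b where "b n = k' + int (\<Sum>t<n. d t)" for n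
  have d_Suc: "d (Suc n) = g (d n)" and b_Suc: "b (Suc n) = b n + int (d n)" for n
    by (auto simp: d_def b_def)
  have b_Q: "Q (b n) (b (Suc n))" for n
  proof (induction n)
    case 0
    then show ?case using k(1) k' \<open>k' < k\<close> by (simp add: Q_def b_def d_def)
  next
    case (Suc n)
    show ?case using step[OF Suc.IH] by (simp add: b_Suc d_Suc)
  qed
  have d_bounds: "0 < d n" "d n < length v" for n using b_Q[of n] by (auto simp: Q_def b_Suc)
  have occ: "occurs_at v x (b n)" and zero: "\<not> x (b n)" for n
    using b_Q[of n] expected_in_F[OF E v] expected_in_F[OF E' v] by (auto simp: Q_def)
  have "\<not> inj d"
  proof
    assume "inj d"
    then have "infinite (range d)" by (simp add: range_inj_infinite)
    moreover have "range d \<subseteq> {..<length v}" using d_bounds by auto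
    ultimately show False using finite_subset by blast
  qed
  then obtain m n where mn: "m < n" "d m = d n" unfolding inj_def by (metis nat_neq_iff)
  have d_per: "d (n + t) = d (m + t)" for t
    by (induction t) (auto simp: d_Suc mn(2))
  define p where "p = nat (b n - b m)"
  have b_mono: "b s + int t \<le> b (s + t)" for s t
  proof (induction t)
    case (Suc t)
    then show ?case using d_bounds(1)[of "s + t"] by (simp add: b_Suc)
  qed simp
  have p: "0 < p" using b_mono[of m "n - m"] mn(1) by (simp add: p_def)
  have b_per: "b (n + t) = b (m + t) + int p" for t
  proof (induction t)
    case 0
    then show ?case using p by (simp add: p_def)
  next
    case (Suc t)
    then show ?case by (simp add: b_Suc d_per)
  qed
  have "degenerate V"
  proof (rule eventually_periodic_imp_degenerate[OF rank1 x p, of "b m"])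
    fix i assume i: "b m \<le> i"
    define t where "t = (LEAST t. i < b (m + Suc t))"
    have "i < b (m + Suc (nat (i - b m)))" using b_mono[of m "Suc (nat (i - b m))"] i by linarith
    then have t: "i < b (m + Suc t)" unfolding t_def by (rule LeastI)
    have le: "b (m + t) \<le> i"
    proof (cases t)
      case (Suc t')
      then have "\<not> i < b (m + Suc t')" using not_less_Least[of t' "\<lambda>t. i < b (m + Suc t)"] by (simp add: t_def)
      then show ?thesis using Suc by simp
    qed (use i in simp)
    define j where "j = nat (i - b (m + t))"
    have j: "i = b (m + t) + int j" "j < length v" using le t d_bounds(2)[of "m + t"] by (auto simp: j_def b_Suc)
    have "i + int p = b (n + t) + int j" using j(1) b_per by simp
    then show "x (i + int p) = x i" using occ j unfolding occurs_at_def by metis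
  next
    fix i
    have "i \<le> b (nat (i - k'))" using b_mono[of 0 "nat (i - k')"] by (simp add: b_def split: if_splits)
    then show "\<exists>j\<ge>i. \<not> x j" using zero by blast
  qed
  then show False using nondegenerate by simp
qed

lemma covering_unique:
  assumes "x \<in> rank1_system V" "v \<in> words_F"
    and "covering_occurrences v x E" "covering_occurrences v x E'"
  shows "E = E'"
  using covering_subset[OF assms] covering_subset[OF assms(1,2,4,3)] by blast

lemma expected_at_iff:
  assumes "x \<in> rank1_system V" "v \<in> words_F" "covering_occurrences v x E"
  shows "expected_at v x k \<longleftrightarrow> k \<in> E"
  using covering_unique[OF assms(1,2,3)] assms(3) unfolding expected_at_def by blast

lemma covering_expected:
  assumes "x \<in> rank1_system V" "v \<in> words_F" "built_from V v"
  shows "covering_occurrences v x {k. expected_at v x k}"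
proof -
  obtain E where E: "covering_occurrences v x E"
    using biinf_built_from_rank1_system[OF assms(1,3,2)] by (auto simp: biinf_built_from_def)
  then show ?thesis using expected_at_iff[OF assms(1,2) E] by simp
qed

text \<open>The coverings of the \<open>f n\<close> subconverge to a covering of the limit, which is
  the only one. The truth value \<open>c\<close> covers both cases at once, so being expected is a
  condition that is open as well as closed.\<close>

lemma expected_at_LIMSEQ:
  assumes f: "f \<longlonglongrightarrow> x" "\<And>n. f n \<in> rank1_system V" and v: "v \<in> words_F" "built_from V v"
    and c: "\<And>n. expected_at v (f n) k \<longleftrightarrow> c"
  shows "expected_at v x k \<longleftrightarrow> c"
proof -
  define e where "e n l \<longleftrightarrow> expected_at v (f n) l" for n l
  obtain r E where r: "strict_mono (r :: nat \<Rightarrow> nat)" "(e \<circ> r) \<longlonglongrightarrow> E"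
    by (rule bool_fun_convergent_subseq)
  have "covering_occurrences v x {k. E k}"
  proof (rule covering_occurrences_LIMSEQ)
    show "(f \<circ> r) \<longlonglongrightarrow> x" by (rule LIMSEQ_subseq_LIMSEQ[OF f(1) r(1)])
    show "\<forall>\<^sub>F n in sequentially. covers_at v ((f \<circ> r) n) {k. (e \<circ> r) n k} i" for i
      using covering_expected[OF f(2) v] by (simp add: covering_occurrences_iff e_def)
  qed (rule r(2))
  then have "expected_at v x k \<longleftrightarrow> E k"
    using expected_at_iff rank1_system_LIMSEQ[OF f] v(1) by blast
  also have "E k \<longleftrightarrow> c"
  proof -
    have "\<forall>\<^sub>F n in sequentially. (e \<circ> r) n k = E k" using r(2) by (simp add: LIMSEQ_bool_fun_iff)
    then show ?thesis using c by (simp add: e_def)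
  qed
  finally show ?thesis .
qed

lemma not_constant_False: "(\<lambda>_. False) \<notin> rank1_system V"
  using eventually_periodic_imp_degenerate[OF rank1, of "\<lambda>_. False" 1 0] nondegenerate by auto

end

text \<open>Otherwise there are pairs that agree on growing windows but differ in \<open>Q\<close>.
  By compactness both members of the pairs subconverge to one point, at which \<open>Q\<close> would
  have to hold and to fail.\<close>

lemma rank1_system_clopen_local:
  fixes Q :: "(int \<Rightarrow> bool) \<Rightarrow> bool"
  assumes clopen: "\<And>f x c. f \<longlonglongrightarrow> x \<Longrightarrow> (\<And>n. f n \<in> rank1_system V) \<Longrightarrow> (\<And>n. Q (f n) = c) \<Longrightarrow> Q x = c"
  obtains R where "\<And>x x'. x \<in> rank1_system V \<Longrightarrow> x' \<in> rank1_system V \<Longrightarrow>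
    (\<And>i. \<bar>i\<bar> \<le> int R \<Longrightarrow> x i = x' i) \<Longrightarrow> Q x = Q x'"
proof -
  have "\<exists>R. \<forall>x x'. x \<in> rank1_system V \<and> x' \<in> rank1_system V \<and>
      (\<forall>i. \<bar>i\<bar> \<le> int R \<longrightarrow> x i = x' i) \<and> Q x \<longrightarrow> Q x'"
  proof (rule ccontr)
    assume "\<not> ?thesis"
    then have "\<forall>R. \<exists>x x'. x \<in> rank1_system V \<and> x' \<in> rank1_system V \<and>
      (\<forall>i. \<bar>i\<bar> \<le> int R \<longrightarrow> x i = x' i) \<and> Q x \<and> \<not> Q x'" by blast
    then obtain f g where fg: "\<And>R. f R \<in> rank1_system V" "\<And>R. g R \<in> rank1_system V"
      "\<And>R i. \<bar>i\<bar> \<le> int R \<Longrightarrow> f R i = g R i" "\<And>R. Q (f R)" "\<And>R. \<not> Q (g R)"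
      by metis
    obtain r l where r: "strict_mono (r :: nat \<Rightarrow> nat)" "(f \<circ> r) \<longlonglongrightarrow> l"
      by (rule bool_fun_convergent_subseq)
    have "(g \<circ> r) \<longlonglongrightarrow> l"
    proof (rule LIMSEQ_bool_fun_growing_windows[OF r(2)])
      fix n i assume "\<bar>i\<bar> \<le> int n"
      then have "\<bar>i\<bar> \<le> int (r n)" using seq_suble[OF r(1), of n] by linarith
      then show "(f \<circ> r) n i = (g \<circ> r) n i" using fg(3) by simp
    qed
    then have "Q l = False" by (rule clopen) (use fg in auto)
    moreover have "Q l = True" by (rule clopen[OF r(2)]) (use fg in auto)
    ultimately show False by simp
  qed
  then obtain R where R: "\<And>x x'. x \<in> rank1_system V \<Longrightarrow> x' \<in> rank1_system V \<Longrightarrow>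
    (\<And>i. \<bar>i\<bar> \<le> int R \<Longrightarrow> x i = x' i) \<Longrightarrow> Q x \<Longrightarrow> Q x'" by blast
  show thesis
  proof (rule that)
    fix x x' assume "x \<in> rank1_system V" "x' \<in> rank1_system V" "\<And>i. \<bar>i\<bar> \<le> int R \<Longrightarrow> x i = x' i"
    then show "Q x = Q x'" using R[of x x'] R[of x' x] by metis
  qed
qed

section \<open>Words cut into similar blocks\<close>

definition zero_count :: "(int \<Rightarrow> bool) \<Rightarrow> int \<Rightarrow> int \<Rightarrow> nat" where
  "zero_count y l h = card {i. l \<le> i \<and> i < h \<and> \<not> y i}"

lemma finite_zeros: "finite {i::int. l \<le> i \<and> i < h \<and> \<not> y i}"
  by (rule finite_subset[of _ "{l..<h}"]) auto

lemma zero_count_add: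
  assumes "l \<le> k" "k \<le> h"
  shows "zero_count y l h = zero_count y l k + zero_count y k h"
proof -
  have "{i. l \<le> i \<and> i < h \<and> \<not> y i} = {i. l \<le> i \<and> i < k \<and> \<not> y i} \<union> {i. k \<le> i \<and> i < h \<and> \<not> y i}"
    using assms by auto
  moreover have "card \<dots> = zero_count y l k + zero_count y k h"
    unfolding zero_count_def by (rule card_Un_disjoint) (auto simp: finite_zeros)
  ultimately show ?thesis by (simp add: zero_count_def)
qed

lemma zero_count_eq_0: "(\<And>i. l \<le> i \<Longrightarrow> i < h \<Longrightarrow> y i) \<Longrightarrow> zero_count y l h = 0"
  unfolding zero_count_def by (subst card_eq_0_iff) blast

lemma zero_count_le:
  assumes "l \<le> h"
  shows "zero_count y l h \<le> nat (h - l)"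
proof -
  have "zero_count y l h \<le> card {l..<h}"
    unfolding zero_count_def by (rule card_mono) auto
  then show ?thesis by simp
qed

lemma zero_count_mono: "l' \<le> l \<Longrightarrow> h \<le> h' \<Longrightarrow> zero_count y l h \<le> zero_count y l' h'"
  unfolding zero_count_def by (rule card_mono) (auto simp: finite_zeros)

lemma zero_count_translate:
  assumes "\<And>i. l \<le> i \<Longrightarrow> i < h \<Longrightarrow> y i = y (i + k)"
  shows "zero_count y l h = zero_count y (l + k) (h + k)"
proof -
  have "i \<in> (\<lambda>i. i + k) ` {i. l \<le> i \<and> i < h \<and> \<not> y i}"
    if "l + k \<le> i" "i < h + k" "\<not> y i" for i
    using that assms[of "i - k"] by (intro image_eqI[of _ _ "i - k"]) auto
  moreover have "l + k \<le> i + k \<and> i + k < h + k \<and> \<not> y (i + k)" if "l \<le> i" "i < h" "\<not> y i" for i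
    using that assms[of i] by simp
  ultimately have "{i. l + k \<le> i \<and> i < h + k \<and> \<not> y i} = (\<lambda>i. i + k) ` {i. l \<le> i \<and> i < h \<and> \<not> y i}"
    by blast
  then show ?thesis unfolding zero_count_def by (simp add: card_image)
qed

lemma zero_count_occurs_at:
  assumes "occurs_at w y k"
  shows "zero_count y k (k + int (length w)) = length (filter Not w)"
proof -
  have "bij_betw (\<lambda>j. k + int j) {j. j < length w \<and> \<not> w ! j}
      {i. k \<le> i \<and> i < k + int (length w) \<and> \<not> y i}"
  proof (rule bij_betw_byWitness[where f' = "\<lambda>i. nat (i - k)"])
    show "(\<lambda>i. nat (i - k)) ` {i. k \<le> i \<and> i < k + int (length w) \<and> \<not> y i} \<subseteq> {j. j < length w \<and> \<not> w ! j}"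
    proof clarify
      fix i assume i: "k \<le> i" "i < k + int (length w)" "\<not> y i"
      define j where "j = nat (i - k)"
      have j: "i = k + int j" "j < length w" using i by (auto simp: j_def)
      then show "nat (i - k) < length w \<and> \<not> w ! nat (i - k)"
        using assms i(3) by (simp add: occurs_at_def)
    qed
  qed (use assms in \<open>auto simp: occurs_at_def\<close>)
  then show ?thesis
    unfolding zero_count_def length_filter_conv_card by (rule bij_betw_same_card[symmetric])
qed

text \<open>To the right of f 0, y consists of copies of w (at the f i) and ones. It is cut into blocks at the
  positions f (\<iota> t); in the application, each block comes from one expected occurrence of v in x.\<close>

locale w_blocks =
  fixes y :: "int \<Rightarrow> bool" and w :: "bool list" and f :: "nat \<Rightarrow> int" and \<iota> :: "nat \<Rightarrow> nat"
    and a b c :: int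
  assumes w: "w \<in> words_F"
    and f_step: "\<And>i. f i + int (length w) \<le> f (Suc i)"
    and f_occ: "\<And>i. occurs_at w y (f i)"
    and f_ones: "\<And>i j. f i + int (length w) \<le> j \<Longrightarrow> j < f (Suc i) \<Longrightarrow> y j"
    and \<iota>_0: "\<iota> 0 = 0" and \<iota>_mono: "\<And>t. \<iota> t < \<iota> (Suc t)"
    and nonneg: "0 \<le> a" "0 \<le> b" "0 \<le> c"
    and prefix: "\<And>t t' k. 0 \<le> k \<Longrightarrow> k < a \<Longrightarrow> y (f (\<iota> t) + k) = y (f (\<iota> t') + k)"
    and suffix: "\<And>t t' k. 0 < k \<Longrightarrow> k \<le> b \<Longrightarrow> y (f (\<iota> (Suc t)) - k) = y (f (\<iota> (Suc t')) - k)"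
    and middle: "\<And>t. f (\<iota> t) + a + c \<le> f (\<iota> (Suc t)) - b"
    and middle_ones: "\<And>t j. f (\<iota> t) + a + c \<le> j \<Longrightarrow> j < f (\<iota> (Suc t)) - b - c \<Longrightarrow> y j"
    and few: "2 * c < int (length (filter Not w))"
begin

abbreviation (input) "L \<equiv> int (length w)"
abbreviation (input) "Z \<equiv> zero_count y"
abbreviation (input) "m0 \<equiv> length (filter Not w)"

lemma L_pos: "0 < L" using w by (auto simp: words_F_def)

lemma zero_start: "\<not> y (f i)"
  using f_occ[of i] w L_pos by (auto simp: occurs_at_def words_F_def hd_conv_nth dest!: spec[of _ 0])

lemma zero_end: "\<not> y (f i + L - 1)"
proof -
  have "f i + L - 1 = f i + int (length w - 1)" using L_pos by (simp add: of_nat_diff Suc_le_eq)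
  moreover have "y (f i + int (length w - 1)) = w ! (length w - 1)"
    using f_occ[of i] L_pos by (simp add: occurs_at_def)
  moreover have "\<not> w ! (length w - 1)" using w by (auto simp: words_F_def last_conv_nth)
  ultimately show ?thesis by metis
qed

lemma f_mono: "i < j \<Longrightarrow> f i + L \<le> f j"
proof (induction j)
  case (Suc j)
  then show ?case using f_step[of j] L_pos by (cases "i = j") auto
qed simp

lemma f_mono_le: "i \<le> j \<Longrightarrow> f i \<le> f j"
  using f_mono[of i j] L_pos by (cases "i = j") auto

lemma Z_f: "Z (f i) (f (i + n)) = n * m0"
proof (induction n)
  case 0
  then show ?case by (simp add: zero_count_eq_0)
next
  case (Suc n)
  let ?k = "f (i + n)"
  have "Z (f i) (f (i + Suc n)) = Z (f i) ?k + (Z ?k (?k + L) + Z (?k + L) (f (i + Suc n)))"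
    using zero_count_add[of ?k "?k + L" "f (i + Suc n)"] zero_count_add[of "f i" ?k "f (i + Suc n)"]
      f_step[of "i + n"] f_mono_le[of i "i + n"] L_pos by simp
  moreover have "Z (?k + L) (f (i + Suc n)) = 0"
    by (rule zero_count_eq_0) (use f_ones[of "i + n"] in auto)
  ultimately show ?case using Suc.IH zero_count_occurs_at[OF f_occ[of "i + n"]] by simp
qed

text \<open>\<open>n1\<close> and \<open>n2\<close> count the zeros of the common prefix and of the
  common suffix of all blocks. The suffix is measured at \<open>f (\<iota> 1)\<close>, the first
  place where a block ends.\<close>

definition "n1 = Z (f (\<iota> 0)) (f (\<iota> 0) + a)"
definition "n2 = Z (f (\<iota> 1) - b) (f (\<iota> 1))"

lemma n1: "Z (f (\<iota> t)) (f (\<iota> t) + a) = n1"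
proof -
  have "Z (f (\<iota> t)) (f (\<iota> t) + a) =
      Z (f (\<iota> t) + (f (\<iota> 0) - f (\<iota> t))) (f (\<iota> t) + a + (f (\<iota> 0) - f (\<iota> t)))"
  proof (rule zero_count_translate)
    show "y i = y (i + (f (\<iota> 0) - f (\<iota> t)))" if "f (\<iota> t) \<le> i" "i < f (\<iota> t) + a" for i
      using prefix[of "i - f (\<iota> t)" t 0] that by (simp add: algebra_simps)
  qed
  then show ?thesis by (simp add: n1_def add.commute)
qed

lemma n2: "Z (f (\<iota> (Suc t)) - b) (f (\<iota> (Suc t))) = n2"
proof -
  have "Z (f (\<iota> (Suc t)) - b) (f (\<iota> (Suc t))) =
      Z (f (\<iota> (Suc t)) - b + (f (\<iota> 1) - f (\<iota> (Suc t)))) (f (\<iota> (Suc t)) + (f (\<iota> 1) - f (\<iota> (Suc t))))"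
  proof (rule zero_count_translate)
    show "y i = y (i + (f (\<iota> 1) - f (\<iota> (Suc t))))"
      if "f (\<iota> (Suc t)) - b \<le> i" "i < f (\<iota> (Suc t))" for i
      using suffix[of "f (\<iota> (Suc t)) - i" t 0] that by (simp add: algebra_simps)
  qed
  then show ?thesis by (simp add: n2_def)
qed

text \<open>Between prefix and suffix, zeros occur only in the two margins of width
  \<open>c\<close>, so at most \<open>2 * c\<close> of them are left undetermined.\<close>

lemma block_count:
  "n1 + n2 \<le> (\<iota> (Suc t) - \<iota> t) * m0"
  "int ((\<iota> (Suc t) - \<iota> t) * m0) \<le> int (n1 + n2) + 2 * c"
proof -
  let ?l = "f (\<iota> t)" and ?h = "f (\<iota> (Suc t))"
  have "(\<iota> (Suc t) - \<iota> t) * m0 = Z ?l ?h"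
    using Z_f[of "\<iota> t" "\<iota> (Suc t) - \<iota> t"] \<iota>_mono[of t] by simp
  also have "\<dots> = Z ?l (?l + a) + (Z (?l + a) (?h - b) + Z (?h - b) ?h)"
    using zero_count_add[of ?l "?l + a" ?h] zero_count_add[of "?l + a" "?h - b" ?h] nonneg middle[of t]
    by simp
  finally have eq: "(\<iota> (Suc t) - \<iota> t) * m0 = n1 + n2 + Z (?l + a) (?h - b)"
    using n1[of t] n2[of t] by simp
  then show "n1 + n2 \<le> (\<iota> (Suc t) - \<iota> t) * m0" by simp
  have "int (Z (?l + a) (?h - b)) \<le> 2 * c"
  proof (cases "?l + a + c \<le> ?h - b - c")
    case True
    then have "Z (?l + a) (?h - b) = Z (?l + a) (?l + a + c) +
        (Z (?l + a + c) (?h - b - c) + Z (?h - b - c) (?h - b))"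
      using zero_count_add[of "?l + a" "?l + a + c" "?h - b"]
        zero_count_add[of "?l + a + c" "?h - b - c" "?h - b"] nonneg by simp
    moreover have "Z (?l + a + c) (?h - b - c) = 0"
      by (rule zero_count_eq_0) (use middle_ones in auto)
    ultimately show ?thesis
      using zero_count_le[of "?l + a" "?l + a + c" y] zero_count_le[of "?h - b - c" "?h - b" y] nonneg
      by simp
  next
    \<comment> \<open>The two margins overlap, and the whole stretch is shorter than
      \<open>2 * c\<close>.\<close>
    case False
    then show ?thesis using zero_count_le[of "?l + a" "?h - b" y] middle[of t] nonneg by simp
  qed
  then show "int ((\<iota> (Suc t) - \<iota> t) * m0) \<le> int (n1 + n2) + 2 * c" using eq by simp
qed

definition "m = \<iota> 1"

text \<open>By \<open>block_count\<close> the zeros of any block form a multiple of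
  \<open>m0\<close> in one fixed interval of length \<open>2 * c < m0\<close>, which contains at
  most one such multiple.\<close>

lemma \<iota>_step: "\<iota> (Suc t) - \<iota> t = m"
proof -
  have le: "\<iota> (Suc t) - \<iota> t \<le> \<iota> (Suc t') - \<iota> t'" for t t'
  proof (rule ccontr)
    assume "\<not> ?thesis"
    then have "Suc (\<iota> (Suc t') - \<iota> t') * m0 \<le> (\<iota> (Suc t) - \<iota> t) * m0" by (intro mult_le_mono) auto
    then have "(\<iota> (Suc t') - \<iota> t') * m0 + m0 \<le> (\<iota> (Suc t) - \<iota> t) * m0" by simp
    moreover have "n1 + n2 \<le> (\<iota> (Suc t') - \<iota> t') * m0" by (rule block_count)
    moreover have "int ((\<iota> (Suc t) - \<iota> t) * m0) \<le> int (n1 + n2) + 2 * c" by (rule block_count)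
    ultimately show False using few by linarith
  qed
  have "\<iota> (Suc t) - \<iota> t = \<iota> (Suc 0) - \<iota> 0" by (rule antisym[OF le le])
  then show ?thesis by (simp add: m_def \<iota>_0)
qed

lemma m_pos: "0 < m" using \<iota>_mono[of 0] by (simp add: m_def)

lemma \<iota>_eq: "\<iota> t = m * t"
proof (induction t)
  case (Suc t)
  then show ?case using \<iota>_step[of t] \<iota>_mono[of t] by simp
qed (simp add: \<iota>_0)

lemma total: "int (m * m0) \<le> int (n1 + n2) + 2 * c"
  using block_count(2)[of 0] by (simp add: \<iota>_step)

section \<open>Comparing the gaps inside different blocks\<close>

definition gap :: "nat \<Rightarrow> nat \<Rightarrow> int" where
  "gap t j = f (m * t + Suc j) - f (m * t + j)"

lemma gap_ge: "L \<le> gap t j"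
  using f_step[of "m * t + j"] by (simp add: gap_def)

lemma f_diff_prefix:
  assumes "\<And>i. i < j \<Longrightarrow> gap t i = gap t' i"
  shows "f (m * t + j) - f (m * t) = f (m * t' + j) - f (m * t')"
  using assms
proof (induction j)
  case (Suc j)
  have "f (m * t + j) - f (m * t) = f (m * t' + j) - f (m * t')"
    by (rule Suc.IH) (simp add: Suc.prems)
  moreover have "gap t j = gap t' j" by (simp add: Suc.prems)
  ultimately show ?case by (simp add: gap_def)
qed simp

lemma f_diff_suffix:
  assumes "\<And>i. j \<le> i \<Longrightarrow> i < m \<Longrightarrow> gap t i = gap t' i" "j \<le> m"
  shows "f (m * Suc t) - f (m * t + j) = f (m * Suc t') - f (m * t' + j)"
  using assms(2,1)
proof (induction rule: inc_induct)
  case base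
  then show ?case by (simp add: add.commute)
next
  case (step j)
  have "f (m * Suc t) - f (m * t + Suc j) = f (m * Suc t') - f (m * t' + Suc j)"
    by (rule step.IH) (simp add: step.prems)
  moreover have "gap t j = gap t' j" using step by simp
  ultimately show ?case by (simp add: gap_def)
qed

text \<open>At the first gap where the blocks differ, the one with the shorter gap already starts
  its next copy of \<open>w\<close>, with a zero, where the other still has a one. The common prefix
  has ended by then, so its zeros lie in the copies \<open>0\<close> to \<open>j\<close>.\<close>

lemma n1_le:
  assumes "j < m" "gap t j \<noteq> gap t' j"
  shows "n1 \<le> Suc j * m0"
  using assms
proof (induction j rule: less_induct)
  case (less j)
  show ?case
  proof (cases "\<exists>i<j. gap t i \<noteq> gap t' i")
    case True
    then obtain i where "i < j" "gap t i \<noteq> gap t' i" by blast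
    then have "n1 \<le> Suc i * m0" using less by simp
    also have "\<dots> \<le> Suc j * m0" using \<open>i < j\<close> by (intro mult_le_mono) auto
    finally show ?thesis .
  next
    case False
    have *: "n1 \<le> Suc j * m0"
      if eq: "\<And>i. i < j \<Longrightarrow> gap t i = gap t' i" and lt: "gap t j < gap t' j" for t t'
    proof -
      define k where "k = f (m * t + Suc j) - f (m * t)"
      have "k = f (m * t' + j) - f (m * t') + gap t j"
        using f_diff_prefix[of j t t'] eq by (simp add: k_def gap_def)
      then have "y (f (m * t') + k)"
        using f_ones[of "m * t' + j" "f (m * t') + k"] lt gap_ge[of t j] by (simp add: gap_def)
      moreover have "\<not> y (f (m * t) + k)" using zero_start by (simp add: k_def)
      moreover have k0: "0 \<le> k" using f_mono_le[of "m * t" "m * t + Suc j"] by (simp add: k_def)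
      ultimately have "a \<le> k" using prefix[of k t t'] by (auto simp: \<iota>_eq not_le[symmetric])
      then have "n1 \<le> Z (f (m * t)) (f (m * t + Suc j))"
        using n1[of t] zero_count_mono[of "f (m * t)" "f (m * t)" "f (m * t) + a" "f (m * t + Suc j)" y]
        by (simp add: \<iota>_eq k_def)
      then show ?thesis using Z_f[of "m * t" "Suc j"] by simp
    qed
    show ?thesis using *[of t t'] *[of t' t] False less.prems(2) by (metis linorder_neqE)
  qed
qed

text \<open>The mirror image of \<open>n1_le\<close>, with blocks aligned at their right ends. At
  the last differing gap, the final zero of copy \<open>j\<close> in the block with the shorter gap
  faces a one in the other block, so the common suffix lies strictly to the right of that
  copy.\<close>

lemma n2_le:
  assumes "j < m" "gap t j \<noteq> gap t' j"
  shows "n2 \<le> (m - Suc j) * m0"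
  using assms
proof (induction "m - j" arbitrary: j rule: less_induct)
  case (less j)
  show ?case
  proof (cases "\<exists>i<m. j < i \<and> gap t i \<noteq> gap t' i")
    case True
    then obtain i where i: "j < i" "i < m" "gap t i \<noteq> gap t' i" by blast
    then have "n2 \<le> (m - Suc i) * m0" using less by simp
    also have "\<dots> \<le> (m - Suc j) * m0" using i by (intro mult_le_mono) auto
    finally show ?thesis .
  next
    case False
    have *: "n2 \<le> (m - Suc j) * m0"
      if eq: "\<And>i. j < i \<Longrightarrow> i < m \<Longrightarrow> gap t i = gap t' i" and lt: "gap t j < gap t' j" for t t'
    proof -
      define z where "z = f (m * t + j) + L - 1"
      define k where "k = f (m * Suc t) - z"
      have le: "f (m * t + Suc j) \<le> f (m * Suc t)" using f_mono_le less.prems(1) by simp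
      have step: "z < f (m * t + Suc j)" using gap_ge[of t j] by (simp add: z_def gap_def)
      have "f (m * Suc t) - f (m * t + Suc j) = f (m * Suc t') - f (m * t' + Suc j)"
        using f_diff_suffix[of "Suc j" t t'] eq less.prems(1) by simp
      then have "f (m * Suc t') - k = f (m * t' + Suc j) - (gap t j - L + 1)"
        by (simp add: k_def z_def gap_def)
      then have one: "y (f (m * Suc t') - k)"
        using f_ones[of "m * t' + j" "f (m * Suc t') - k"] lt gap_ge[of t j] by (simp add: gap_def)
      have zero: "\<not> y (f (m * Suc t) - k)" using zero_end[of "m * t + j"] by (simp add: k_def z_def add_diff_eq)
      have "b < k"
      proof (rule ccontr)
        assume "\<not> b < k"
        moreover have "0 < k" using le step by (simp add: k_def)
        ultimately have "y (f (m * Suc t) - k) = y (f (m * Suc t') - k)"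
          using suffix[of k t t'] by (simp only: \<iota>_eq not_less)
        then show False using one zero by simp
      qed
      then have "n2 \<le> Z (z + 1) (f (m * Suc t))"
        using n2[of t] zero_count_mono[of "z + 1" "f (m * Suc t) - b" "f (m * Suc t)" "f (m * Suc t)" y]
        by (simp add: \<iota>_eq k_def)
      also have "\<dots> = Z (z + 1) (f (m * t + Suc j)) + Z (f (m * t + Suc j)) (f (m * Suc t))"
        using step le by (intro zero_count_add) auto
      also have "Z (z + 1) (f (m * t + Suc j)) = 0"
        by (rule zero_count_eq_0) (use f_ones[of "m * t + j"] in \<open>auto simp: z_def\<close>)
      also have "Z (f (m * t + Suc j)) (f (m * Suc t)) = (m - Suc j) * m0"
        using Z_f[of "m * t + Suc j" "m - Suc j"] less.prems(1) by (simp add: add.commute)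
      finally show ?thesis by simp
    qed
    show ?thesis using *[of t t'] *[of t' t] False less.prems(2) by (metis linorder_neqE)
  qed
qed

text \<open>If the gaps \<open>i < j\<close> both differed, the prefix would end by copy
  \<open>i\<close> and the suffix start after copy \<open>j\<close>. The \<open>m0\<close> zeros of
  copy \<open>j\<close> would then be missing from \<open>n1 + n2\<close>, against
  \<open>total\<close> and \<open>few\<close>.\<close>

lemma gap_differ_once:
  assumes "i < m" "j < m" "gap t i \<noteq> gap t' i" "gap t j \<noteq> gap t' j"
  shows "i = j"
proof -
  have *: False if "i < j" "j < m" "gap t i \<noteq> gap t' i" "gap t j \<noteq> gap t' j" for i j
  proof -
    have "n1 \<le> Suc i * m0" "n2 \<le> (m - Suc j) * m0" using n1_le[of i t t'] n2_le[of j t t'] that by auto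
    then have "n1 + n2 + m0 \<le> (Suc i + (m - Suc j) + 1) * m0" by (simp add: algebra_simps)
    also have "\<dots> \<le> m * m0" using that by (intro mult_le_mono) auto
    finally show False using total few by linarith
  qed
  show ?thesis using *[of i j] *[of j i] assms by (metis linorder_neqE_nat)
qed

text \<open>Two blocks \<open>t0\<close>, \<open>t1\<close> that differ at \<open>j\<close> fix the
  place. A block that differed from \<open>t0\<close> at another \<open>i\<close> would agree with
  \<open>t0\<close> at \<open>j\<close> and hence differ from \<open>t1\<close> there, so it would
  agree with \<open>t1\<close> at \<open>i\<close>; then \<open>t0\<close> and \<open>t1\<close>
  would differ at \<open>i\<close> too.\<close>

lemma gap_differ_in_one_place:
  obtains j where "j < m" "\<And>t t' i. i < m \<Longrightarrow> i \<noteq> j \<Longrightarrow> gap t i = gap t' i"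
proof (cases "\<exists>j<m. \<exists>t t'. gap t j \<noteq> gap t' j")
  case False
  then show thesis using that[of 0] m_pos by blast
next
  case True
  then obtain j t0 t1 where j: "j < m" "gap t0 j \<noteq> gap t1 j" by blast
  have "gap t i = gap t0 i" if "i < m" "i \<noteq> j" for t i
    using gap_differ_once[of i j t t0] gap_differ_once[of i j t t1] gap_differ_once[of i j t0 t1] j that
    by metis
  then show thesis using that[of j] j(1) by metis
qed

text \<open>The blocks of the new word U start after the only gap that varies.\<close>

lemma rotated_blocks:
  obtains U C where "U \<in> words_F"
    "\<And>t. occurs_at U y (f (\<iota> (Suc t)) - C)"
    "\<And>t. f (\<iota> (Suc t)) - C + int (length U) \<le> f (\<iota> (Suc (Suc t))) - C"
    "\<And>t i. f (\<iota> (Suc t)) - C + int (length U) \<le> i \<Longrightarrow> i < f (\<iota> (Suc (Suc t))) - C \<Longrightarrow> y i"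
proof -
  obtain j where j: "j < m" "\<And>t t' i. i < m \<Longrightarrow> i \<noteq> j \<Longrightarrow> gap t i = gap t' i"
    using gap_differ_in_one_place by metis
  \<comment> \<open>The start of copy number \<open>n\<close>, counted from the first copy after the
    varying gap \<open>j\<close> of block \<open>t\<close>. The index runs on into block
    \<open>t + 1\<close>.\<close>
  define g where "g t n = f (m * t + Suc j + n)" for t n
  \<comment> \<open>The distance from the copy after gap \<open>j\<close> to the end of its block;
    it is the same in every block because the gaps after \<open>j\<close> are.\<close>
  define C where "C = f (m * 1) - f (m * 0 + Suc j)"
  have G: "f (\<iota> (Suc t)) - C = g t 0" for t
    using f_diff_suffix[of "Suc j" t 0] j by (simp add: \<iota>_eq C_def g_def)
  have g_step: "g t (Suc n) - g t n = g 0 (Suc n) - g 0 n" if n: "Suc n < m" for t n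
  proof (cases "Suc (j + n) < m")
    case True
    then show ?thesis using j(2)[of "Suc (j + n)" t 0] by (simp add: gap_def g_def add_ac)
  next
    \<comment> \<open>The gap is already in block \<open>t + 1\<close>, at an index
      \<open>i < j\<close>, hence again not the varying one.\<close>
    case False
    define i where "i = Suc (j + n) - m"
    have i: "Suc (j + n) = m + i" "i < m" "i \<noteq> j" using False n j(1) by (auto simp: i_def)
    have "m * t + Suc j + n = m * Suc t + i" "m * t + Suc j + Suc n = m * Suc t + Suc i" for t
      using i(1) by auto
    then have "g t (Suc n) - g t n = gap (Suc t) i" for t unfolding g_def gap_def by presburger
    then show ?thesis using j(2)[OF i(2,3)] by metis
  qed
  have g_diff: "g t n - g t 0 = g 0 n - g 0 0" if "n < m" for t n
    using that
  proof (induction n)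
    case (Suc n)
    then show ?case using g_step[of n t] by simp
  qed simp
  have agree: "y (g t 0 + k) = y (g 0 0 + k)" if "n < m" "0 \<le> k" "k < g 0 n - g 0 0 + L" for t n k
    using that
  proof (induction n)
    case 0
    then have "y (g s 0 + k) = w ! nat k" for s
      using f_occ[of "m * s + Suc j"] unfolding occurs_at_def g_def
      by (metis add.right_neutral add_diff_cancel_left' diff_self nat_0_le nat_less_iff add_0)
    then show ?case by simp
  next
    case (Suc n)
    have S: "g s (Suc n) = f (Suc (m * s + Suc j + n))" for s by (simp add: g_def)
    consider "k < g 0 n - g 0 0 + L" | "g 0 n - g 0 0 + L \<le> k" "k < g 0 (Suc n) - g 0 0"
      | "g 0 (Suc n) - g 0 0 \<le> k" by linarith
    then show ?case
    proof cases
      case 1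
      then show ?thesis using Suc by simp
    next
      case 2
      have "y (g s 0 + k)" for s
        using f_ones[of "m * s + Suc j + n" "g s 0 + k"] 2 g_diff[of n s] g_diff[of "Suc n" s] Suc.prems(1) S
        by (simp add: g_def)
      then show ?thesis by simp
    next
      case 3
      define l where "l = nat (k - (g 0 (Suc n) - g 0 0))"
      have l: "l < length w" using Suc.prems(3) 3 by (simp add: l_def nat_less_iff)
      have "g s 0 + k = g s (Suc n) + int l" for s
        using g_diff[of "Suc n" s] Suc.prems(1) 3 by (simp add: l_def)
      then have "y (g s 0 + k) = w ! l" for s
        using f_occ[of "m * s + Suc j + Suc n"] l unfolding occurs_at_def g_def by metis
      then show ?thesis by simp
    qed
  qed
  \<comment> \<open>From the start of the first of the \<open>m\<close> copies to the end of the
    last. The varying gap comes after that and consists of ones outside \<open>U\<close>.\<close>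
  define N where "N = nat (g 0 (m - 1) - g 0 0 + L)"
  have "g 0 0 \<le> g 0 (m - 1)" unfolding g_def by (intro f_mono_le) simp
  then have "0 < g 0 (m - 1) - g 0 0 + L" using L_pos by linarith
  then have N: "int N = g 0 (m - 1) - g 0 0 + L" "0 < N" unfolding N_def by simp_all
  define U where "U = map (\<lambda>i. y (g 0 0 + int i)) [0..<N]"
  have len: "length U = N" by (simp add: U_def)
  have last: "g t 0 + int N = g t (m - 1) + L" for t
    using N(1) g_diff[of "m - 1" t] m_pos by simp
  have next_block: "g (Suc t) 0 = f (Suc (m * t + Suc j + (m - 1)))" for t
    using m_pos by (simp add: g_def add_ac)
  show thesis
  proof (rule that[of U C])
    have "hd U = y (g 0 0)" "last U = y (g 0 0 + int (N - 1))"
      using N(2) by (auto simp: U_def hd_map last_map hd_conv_nth)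
    moreover have "g 0 0 + int (N - 1) = g 0 (m - 1) + L - 1" using last[of 0] N(2) by simp
    moreover have "\<not> y (g 0 0)" "\<not> y (g 0 (m - 1) + L - 1)"
      unfolding g_def by (rule zero_start, rule zero_end)
    moreover have "U \<noteq> []" using N(2) by (simp add: U_def)
    ultimately show "U \<in> words_F" by (simp add: words_F_def)
    show "occurs_at U y (f (\<iota> (Suc t)) - C)" for t
      unfolding G occurs_at_def len
    proof (intro allI impI)
      fix k assume "k < N"
      then show "y (g t 0 + int k) = U ! k"
        using agree[of "m - 1" "int k" t] N(1) m_pos by (simp add: U_def)
    qed
    show "f (\<iota> (Suc t)) - C + int (length U) \<le> f (\<iota> (Suc (Suc t))) - C" for t
      unfolding G len last next_block using f_step by (simp add: g_def)
    show "y i" if "f (\<iota> (Suc t)) - C + int (length U) \<le> i" "i < f (\<iota> (Suc (Suc t))) - C" for t i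
      using that f_ones[of "m * t + Suc j + (m - 1)" i] unfolding G len last next_block by (simp add: g_def)
  qed
qed

end

section \<open>Isomorphisms\<close>

lemma covering_enumeration:
  assumes cov: "covering_occurrences v x E" and v: "v \<in> words_F" and e: "e \<in> E"
    and unbounded: "\<And>N. \<exists>k\<ge>N. k \<in> E"
  obtains f :: "nat \<Rightarrow> int" where "f 0 = e" "range f = {k \<in> E. e \<le> k}" "strict_mono f"
    "\<And>n. f n + int (length v) \<le> f (Suc n)"
    "\<And>n. occurs_at v x (f n)"
    "\<And>n j. f n + int (length v) \<le> j \<Longrightarrow> j < f (Suc n) \<Longrightarrow> x j"
proof -
  define S where "S = {n. e + int n \<in> E}"
  define f where "f n = e + int (enumerate S n)" for n
  have inf: "infinite S"
    unfolding infinite_nat_iff_unbounded_le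
  proof
    fix N
    obtain k where "k \<ge> e + int N" "k \<in> E" using unbounded by blast
    then show "\<exists>n\<ge>N. n \<in> S" by (intro exI[of _ "nat (k - e)"]) (auto simp: S_def)
  qed
  have mono: "strict_mono f"
    using enumerate_mono[OF _ inf] by (auto simp: strict_mono_def f_def)
  have "0 \<in> S" using e by (simp add: S_def)
  then have "enumerate S 0 = 0" by (simp add: enumerate_0 Least_equality)
  then have f0: "f 0 = e" by (simp add: f_def)
  have range: "range f = {k \<in> E. e \<le> k}"
  proof
    show "range f \<subseteq> {k \<in> E. e \<le> k}"
      using enumerate_in_set[OF inf] by (auto simp: f_def S_def)
    show "{k \<in> E. e \<le> k} \<subseteq> range f"
    proof
      fix k assume k: "k \<in> {k \<in> E. e \<le> k}"
      then have "nat (k - e) \<in> S" by (simp add: S_def)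
      then obtain n where "enumerate S n = nat (k - e)" using enumerate_Ex[OF inf] by metis
      then have "k = f n" using k by (simp add: f_def)
      then show "k \<in> range f" by simp
    qed
  qed
  then have in_E: "f n \<in> E" for n by blast
  show thesis
  proof (rule that[OF f0 range mono])
    show "f n + int (length v) \<le> f (Suc n)" for n
      using covering_separated[OF cov v in_E in_E] mono by (simp add: strict_mono_def)
    show "occurs_at v x (f n)" for n using expected_in_F(1)[OF cov v in_E] .
    show "x j" if j: "f n + int (length v) \<le> j" "j < f (Suc n)" for n j
    proof (rule ccontr)
      assume "\<not> x j"
      then obtain k where k: "k \<in> E" "k \<le> j" "j < k + int (length v)"
        using cov unfolding covering_occurrences_def by blast
      then have fk: "f n < k" "k < f (Suc n)" using j by linarith+
      have "e \<le> f n" using range by blast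
      then have "k \<in> range f" using range k(1) fk(1) by simp
      then obtain l where "k = f l" by blast
      then show False using fk mono by (simp add: strict_mono_less)
    qed
  qed
qed

lemma rank1_word_zeros_unbounded: "rank1_word V \<Longrightarrow> \<exists>j\<ge>N. \<not> V !! j"
  by (rule rank1_word_recurrence[of V N 1]) (use rank1_word_starts_False[of V] in auto)

lemma rank1_word_many_zeros:
  assumes "rank1_word V"
  obtains v where "v \<in> words_F" "built_from V v" "n < length (filter Not v)"
proof -
  have "infinite {j. \<not> V !! j}"
    using rank1_word_zeros_unbounded[OF assms] by (simp add: infinite_nat_iff_unbounded_le)
  then obtain S where S: "S \<subseteq> {j. \<not> V !! j}" "finite S" "card S = Suc n"
    using infinite_arbitrarily_large by metis
  obtain v where v: "v \<in> words_F" "built_from V v" "Max S < length v"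
    using rank1_word_long[OF assms] by metis
  then have ne: "v \<noteq> []" by auto
  have "S \<subseteq> {j. j < length v \<and> \<not> v ! j}"
  proof
    fix j assume j: "j \<in> S"
    then have "j < length v" using Max_ge[OF S(2) j] v(3) by linarith
    then show "j \<in> {j. j < length v \<and> \<not> v ! j}"
      using built_from_prefix[OF v(2) ne] j S(1) by auto
  qed
  then have "Suc n \<le> length (filter Not v)"
    using S(3) card_mono[of "{j. j < length v \<and> \<not> v ! j}" S] by (simp add: length_filter_conv_card)
  then show thesis using that v by simp
qed

locale rank1_isomorphism = X: nondegenerate_rank1 V + Y: nondegenerate_rank1 W
  for V W +
  fixes \<phi> :: "(int \<Rightarrow> bool) \<Rightarrow> int \<Rightarrow> bool"
  assumes iso: "topological_isomorphism (rank1_system V) (rank1_system W) \<phi>"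
begin

abbreviation (input) "X \<equiv> rank1_system V"
abbreviation (input) "Y \<equiv> rank1_system W"

lemma \<phi>_image: "\<phi> ` X = Y" and \<phi>_continuous: "continuous_on X \<phi>"
  using iso unfolding topological_isomorphism_def homeomorphism_def by auto

lemma \<phi>_mem: "x \<in> X \<Longrightarrow> \<phi> x \<in> Y"
  using \<phi>_image by blast

lemma \<phi>_LIMSEQ:
  assumes "f \<longlonglongrightarrow> x" "\<And>n. f n \<in> X"
  shows "(\<lambda>n. \<phi> (f n)) \<longlonglongrightarrow> \<phi> x"
  by (rule continuous_on_tendsto_compose[OF \<phi>_continuous assms(1)])
    (use rank1_system_LIMSEQ[OF assms] assms(2) in auto)

lemma \<phi>_shift_power:
  assumes "x \<in> X"
  shows "\<phi> (shift_power n x) = shift_power n (\<phi> x)"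
proof -
  have nonneg: "\<phi> (shift_power (int k) x) = shift_power (int k) (\<phi> x)" if "x \<in> X" for k x
  proof (induction k)
    case (Suc k)
    have eq: "shift_power (int (Suc k)) u = shift (shift_power (int k) u)" for u
      by (simp add: shift_eq_shift_power shift_power_shift_power)
    have "\<phi> (shift (shift_power (int k) x)) = shift (\<phi> (shift_power (int k) x))"
      using iso shift_power_rank1_system[OF that] by (simp add: topological_isomorphism_def)
    then show ?case by (simp only: eq Suc.IH)
  qed (simp add: shift_power_0)
  show ?thesis
  proof (cases "0 \<le> n")
    case True
    then show ?thesis using nonneg[OF assms, of "nat n"] by simp
  next
    case False
    have "\<phi> x = \<phi> (shift_power (int (nat (- n))) (shift_power n x))"
      using False by (simp add: shift_power_shift_power shift_power_0)
    also have "\<dots> = shift_power (int (nat (- n))) (\<phi> (shift_power n x))"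
      by (rule nonneg[OF shift_power_rank1_system[OF assms]])
    finally have "shift_power n (\<phi> x) = shift_power (n + int (nat (- n))) (\<phi> (shift_power n x))"
      by (simp only: shift_power_shift_power)
    then show ?thesis using False by (simp add: shift_power_0)
  qed
qed

text \<open>The image of a fixed point of the shift is constant, and non-degeneracy excludes the
  constant word of zeros.\<close>

lemma \<phi>_ones:
  assumes "(\<lambda>_. True) \<in> X"
  shows "\<phi> (\<lambda>_. True) = (\<lambda>_. True)"
proof -
  let ?y = "\<phi> (\<lambda>_. True)"
  have "shift_power n (\<lambda>_. True) = (\<lambda>_. True)" for n by (rule ext) (simp add: shift_power_apply)
  then have "shift_power n ?y = ?y" for n using \<phi>_shift_power[OF assms, of n] by simp
  then have "?y n = ?y 0" for n by (metis shift_power_apply add_0)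
  then have "?y = (\<lambda>_. ?y 0)" by blast
  then show ?thesis using \<phi>_mem[OF assms] Y.not_constant_False by (cases "?y 0") auto
qed

text \<open>The first rule says that \<open>\<phi>\<close> is a sliding block code. For the second,
  if a window of ones of every radius could produce a zero, the limit would put the constant word of
  ones into \<open>X\<close> and contradict \<open>\<phi>_ones\<close>.\<close>

lemma \<phi>_local:
  obtains r :: nat where
    "\<And>x x' k k'. x \<in> X \<Longrightarrow> x' \<in> X \<Longrightarrow> (\<And>i. \<bar>i\<bar> \<le> int r \<Longrightarrow> x (k + i) = x' (k' + i)) \<Longrightarrow> \<phi> x k = \<phi> x' k'"
    "\<And>x k. x \<in> X \<Longrightarrow> (\<And>i. \<bar>i\<bar> \<le> int r \<Longrightarrow> x (k + i)) \<Longrightarrow> \<phi> x k"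
proof -
  obtain r1 where r1: "\<And>x x'. x \<in> X \<Longrightarrow> x' \<in> X \<Longrightarrow> (\<And>i. \<bar>i\<bar> \<le> int r1 \<Longrightarrow> x i = x' i) \<Longrightarrow> \<phi> x 0 = \<phi> x' 0"
  proof (rule rank1_system_clopen_local[of V "\<lambda>x. \<phi> x 0"])
    fix f x c assume f: "f \<longlonglongrightarrow> x" "\<And>n. f n \<in> X" "\<And>n. \<phi> (f n) 0 = c"
    have "\<forall>\<^sub>F n in sequentially. \<phi> (f n) 0 = \<phi> x 0"
      using \<phi>_LIMSEQ[OF f(1,2)] by (simp add: LIMSEQ_bool_fun_iff)
    then show "\<phi> x 0 = c" using f(3) by simp
  qed blast
  have "\<exists>r2. \<forall>x\<in>X. (\<forall>i. \<bar>i\<bar> \<le> int r2 \<longrightarrow> x i) \<longrightarrow> \<phi> x 0"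
  proof (rule ccontr)
    assume "\<not> ?thesis"
    then obtain f where f: "\<And>n. f n \<in> X" "\<And>n i. \<bar>i\<bar> \<le> int n \<Longrightarrow> f n i" "\<And>n. \<not> \<phi> (f n) 0" by metis
    have "(\<lambda>n i. True) \<longlonglongrightarrow> (\<lambda>i::int. True)" by simp
    then have lim: "f \<longlonglongrightarrow> (\<lambda>_. True)"
      by (rule LIMSEQ_bool_fun_growing_windows) (simp add: f(2))
    have "\<forall>\<^sub>F n in sequentially. \<phi> (f n) 0 = \<phi> (\<lambda>_. True) 0"
      using \<phi>_LIMSEQ[OF lim f(1)] by (simp add: LIMSEQ_bool_fun_iff)
    then show False using f(3) \<phi>_ones rank1_system_LIMSEQ[OF lim f(1)] by simp
  qed
  then obtain r2 where r2: "\<And>x. x \<in> X \<Longrightarrow> (\<And>i. \<bar>i\<bar> \<le> int r2 \<Longrightarrow> x i) \<Longrightarrow> \<phi> x 0" by blast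
  have at_0: "\<phi> (shift_power k x) 0 = \<phi> x k" if "x \<in> X" for x k
    using \<phi>_shift_power[OF that] by (simp add: shift_power_apply)
  show thesis
  proof (rule that[of "max r1 r2"])
    fix x x' k k' assume x: "x \<in> X" "x' \<in> X" "\<And>i. \<bar>i\<bar> \<le> int (max r1 r2) \<Longrightarrow> x (k + i) = x' (k' + i)"
    have "\<phi> (shift_power k x) 0 = \<phi> (shift_power k' x') 0"
      by (rule r1) (use x shift_power_rank1_system in \<open>auto simp: shift_power_apply add.commute\<close>)
    then show "\<phi> x k = \<phi> x' k'" using at_0 x by simp
  next
    fix x k assume x: "x \<in> X" "\<And>i. \<bar>i\<bar> \<le> int (max r1 r2) \<Longrightarrow> x (k + i)"
    have "\<phi> (shift_power k x) 0"
      by (rule r2) (use x shift_power_rank1_system in \<open>auto simp: shift_power_apply add.commute\<close>)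
    then show "\<phi> x k" using at_0 x by simp
  qed
qed

lemma expected_at_\<phi>_local:
  assumes w: "w \<in> words_F" "built_from W w"
  obtains R :: nat where
    "\<And>x x' k k'. x \<in> X \<Longrightarrow> x' \<in> X \<Longrightarrow> (\<And>i. \<bar>i\<bar> \<le> int R \<Longrightarrow> x (k + i) = x' (k' + i)) \<Longrightarrow>
      expected_at w (\<phi> x) k = expected_at w (\<phi> x') k'"
proof -
  obtain R where R: "\<And>x x'. x \<in> X \<Longrightarrow> x' \<in> X \<Longrightarrow> (\<And>i. \<bar>i\<bar> \<le> int R \<Longrightarrow> x i = x' i) \<Longrightarrow>
    expected_at w (\<phi> x) 0 = expected_at w (\<phi> x') 0"
  proof (rule rank1_system_clopen_local[of V "\<lambda>x. expected_at w (\<phi> x) 0"])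
    fix f x c assume f: "f \<longlonglongrightarrow> x" "\<And>n. f n \<in> X" "\<And>n. expected_at w (\<phi> (f n)) 0 = c"
    show "expected_at w (\<phi> x) 0 = c"
      using Y.expected_at_LIMSEQ[OF \<phi>_LIMSEQ[OF f(1,2)] _ w] \<phi>_mem f by blast
  qed blast
  have at_0: "expected_at w (\<phi> (shift_power k x)) 0 = expected_at w (\<phi> x) k" if "x \<in> X" for x k
    using \<phi>_shift_power[OF that] by (simp add: expected_at_shift_power)
  show thesis
  proof (rule that[of R])
    fix x x' k k' assume x: "x \<in> X" "x' \<in> X" "\<And>i. \<bar>i\<bar> \<le> int R \<Longrightarrow> x (k + i) = x' (k' + i)"
    have "expected_at w (\<phi> (shift_power k x)) 0 = expected_at w (\<phi> (shift_power k' x')) 0"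
      by (rule R) (use x shift_power_rank1_system in \<open>auto simp: shift_power_apply add.commute\<close>)
    then show "expected_at w (\<phi> x) k = expected_at w (\<phi> x') k'" using at_0 x by simp
  qed
qed

end

text \<open>The preceding lemma applied to the identity isomorphism.\<close>

lemma (in nondegenerate_rank1) expected_at_local:
  assumes v: "v \<in> words_F" "built_from V v"
  obtains R :: nat where
    "\<And>x x' k k'. x \<in> rank1_system V \<Longrightarrow> x' \<in> rank1_system V \<Longrightarrow>
      (\<And>i. \<bar>i\<bar> \<le> int R \<Longrightarrow> x (k + i) = x' (k' + i)) \<Longrightarrow> expected_at v x k = expected_at v x' k'"
proof -
  interpret id: rank1_isomorphism V V id
  proof
    show "topological_isomorphism (rank1_system V) (rank1_system V) id"
      unfolding topological_isomorphism_def
      by (auto intro!: exI[of _ id] homeomorphismI continuous_on_id)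
  qed
  show thesis using id.expected_at_\<phi>_local[OF v] that by auto
qed

context rank1_isomorphism
begin

text \<open>Surjectivity gives an \<open>x\<close> whose image has a zero at \<open>0\<close>; the
  window of \<open>x\<close> that produces this zero recurs in \<open>z\<close> arbitrarily far to
  the right.\<close>

lemma \<phi>_zeros_unbounded:
  assumes z: "z \<in> X" and dense: "\<And>x M N. x \<in> X \<Longrightarrow> \<exists>n\<ge>N. \<forall>i. \<bar>i\<bar> \<le> M \<longrightarrow> x i = z (n + i)"
  shows "\<exists>j\<ge>N. \<not> \<phi> z j"
proof -
  obtain r where r: "\<And>x x' k k'. x \<in> X \<Longrightarrow> x' \<in> X \<Longrightarrow>
    (\<And>i. \<bar>i\<bar> \<le> int r \<Longrightarrow> x (k + i) = x' (k' + i)) \<Longrightarrow> \<phi> x k = \<phi> x' k'"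
    using \<phi>_local by metis
  obtain y where y: "y \<in> Y" "\<And>n. y (int n) = W !! n"
    using rank1_system_transitive_point[OF Y.rank1] by metis
  obtain x where x: "x \<in> X" "\<phi> x = y" using \<phi>_image y(1) by (metis imageE)
  obtain n where n: "n \<ge> N" "\<And>i. \<bar>i\<bar> \<le> int r \<Longrightarrow> x i = z (n + i)" using dense[OF x(1), of N "int r"] by blast
  have "\<phi> x 0 = \<phi> z n" by (rule r[OF x(1) z]) (simp add: n(2))
  moreover have "\<not> \<phi> x 0" using y(2)[of 0] rank1_word_starts_False[OF Y.rank1] x(2) by simp
  ultimately show ?thesis using n(1) by blast
qed

text \<open>One transitive point z suffices: by locality, a relation between z and \<phi> z that holds far to the
  right is a relation between x and \<phi> x for every x in X.\<close>

lemma covering_transfer: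
  assumes v: "v \<in> words_F" "built_from V v" and z: "z \<in> X"
    and dense: "\<And>x M N. x \<in> X \<Longrightarrow> \<exists>n\<ge>N. \<forall>i. \<bar>i\<bar> \<le> M \<longrightarrow> x i = z (n + i)"
    and cov: "\<And>i. N \<le> i \<Longrightarrow> covers_at U (\<phi> z) {k. expected_at v z (k - c)} i"
    and x: "x \<in> X"
  shows "covering_occurrences U (\<phi> x) {k. expected_at v x (k - c)}"
  unfolding covering_occurrences_iff
proof
  fix i
  obtain r where r: "\<And>x x' k k'. x \<in> X \<Longrightarrow> x' \<in> X \<Longrightarrow>
    (\<And>i. \<bar>i\<bar> \<le> int r \<Longrightarrow> x (k + i) = x' (k' + i)) \<Longrightarrow> \<phi> x k = \<phi> x' k'"
    using \<phi>_local by metis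
  obtain R where R: "\<And>x x' k k'. x \<in> X \<Longrightarrow> x' \<in> X \<Longrightarrow>
      (\<And>i. \<bar>i\<bar> \<le> int R \<Longrightarrow> x (k + i) = x' (k' + i)) \<Longrightarrow> expected_at v x k = expected_at v x' k'"
    using X.expected_at_local[OF v] by metis
  \<comment> \<open>Wide enough for the windows \<open>r\<close> and \<open>R\<close> around every
    position that \<open>covers_at\<close> inspects near \<open>i\<close>, including the
    displacement by \<open>c\<close>.\<close>
  define M where "M = \<bar>i\<bar> + \<bar>c\<bar> + int (length U) + int r + int R"
  obtain n where n: "n \<ge> N + \<bar>i\<bar>" "\<And>j. \<bar>j\<bar> \<le> M \<Longrightarrow> x j = z (n + j)"
    using dense[OF x] by blast
  have "covers_at U (\<phi> x) {k. expected_at v x (k - c)} i =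
      covers_at U (\<phi> z) {k. expected_at v z (k - c)} (n + i)"
  proof (rule covers_at_cong)
    fix l assume l: "\<bar>l\<bar> \<le> int (length U)"
    show "\<phi> x (i + l) = \<phi> z (n + i + l)"
    proof (rule r[OF x z])
      fix j assume "\<bar>j\<bar> \<le> int r"
      then have "\<bar>i + l + j\<bar> \<le> M" using l by (simp add: M_def)
      then show "x (i + l + j) = z (n + i + l + j)" using n(2) by (simp add: add.assoc)
    qed
    have "expected_at v x (i + l - c) = expected_at v z (n + i + l - c)"
    proof (rule R[OF x z])
      fix j assume "\<bar>j\<bar> \<le> int R"
      then have "\<bar>i + l - c + j\<bar> \<le> M" using l by (simp add: M_def)
      then have "x (i + l - c + j) = z (n + (i + l - c + j))" by (rule n(2))
      then show "x (i + l - c + j) = z (n + i + l - c + j)" by (simp add: algebra_simps)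
    qed
    then show "i + l \<in> {k. expected_at v x (k - c)} \<longleftrightarrow> n + i + l \<in> {k. expected_at v z (k - c)}"
      by simp
  qed
  moreover have "N \<le> n + i" using n(1) by linarith
  ultimately show "covers_at U (\<phi> x) {k. expected_at v x (k - c)} i" using cov by blast
qed

lemma transitive_covering:
  assumes z: "z \<in> X" "\<And>n. z (int n) = V !! n"
    and dense: "\<And>x M N. x \<in> X \<Longrightarrow> \<exists>n\<ge>N. \<forall>i. \<bar>i\<bar> \<le> M \<longrightarrow> x i = z (n + i)"
  obtains v U c N where "v \<in> words_F" "built_from V v" "U \<in> words_F"
    "\<And>i. N \<le> i \<Longrightarrow> covers_at U (\<phi> z) {k. expected_at v z (k - c)} i"
proof -
  obtain r where r: "\<And>x x' k k'. x \<in> X \<Longrightarrow> x' \<in> X \<Longrightarrow>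
      (\<And>i. \<bar>i\<bar> \<le> int r \<Longrightarrow> x (k + i) = x' (k' + i)) \<Longrightarrow> \<phi> x k = \<phi> x' k'"
    and r_ones: "\<And>x k. x \<in> X \<Longrightarrow> (\<And>i. \<bar>i\<bar> \<le> int r \<Longrightarrow> x (k + i)) \<Longrightarrow> \<phi> x k"
    using \<phi>_local by metis
  obtain w where w: "w \<in> words_F" "built_from W w" "4 * r < length (filter Not w)"
    using rank1_word_many_zeros[OF Y.rank1] by metis
  obtain R where R: "\<And>x x' k k'. x \<in> X \<Longrightarrow> x' \<in> X \<Longrightarrow>
      (\<And>i. \<bar>i\<bar> \<le> int R \<Longrightarrow> x (k + i) = x' (k' + i)) \<Longrightarrow>
      expected_at w (\<phi> x) k = expected_at w (\<phi> x') k'"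
    using expected_at_\<phi>_local[OF w(1,2)] by metis
  define y where "y = \<phi> z"
  have y: "y \<in> Y" using \<phi>_mem[OF z(1)] by (simp add: y_def)
  define F where "F = {k. expected_at w y k}"
  have F: "covering_occurrences w y F" unfolding F_def by (rule Y.covering_expected[OF y w(1,2)])

  \<comment> \<open>The zero is taken so far right that the expected \<open>w\<close> containing it
    starts at some \<open>s \<ge> R + r\<close>. The window of radius \<open>R\<close> around
    \<open>s\<close> then lies in the right half of \<open>z\<close>, where \<open>z\<close> is
    \<open>V\<close>, and inside the prefix \<open>v\<close> chosen next.\<close>
  obtain i where i: "i \<ge> int R + int r + int (length w)" "\<not> y i"
    using \<phi>_zeros_unbounded[OF z(1) dense] unfolding y_def by blast
  then obtain s where s: "s \<in> F" "i < s + int (length w)"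
    using F unfolding covering_occurrences_def by blast
  have s_ge: "int R + int r \<le> s" using i s(2) by linarith

  obtain v where v: "v \<in> words_F" "built_from V v" "nat s + R + r < length v"
    using rank1_word_long[OF X.rank1] by metis
  then have v_ne: "v \<noteq> []" by auto
  have v_long: "s + int R + int r < int (length v)" using v(3) s_ge by linarith
  define E where "E = {k. expected_at v z k}"
  have E: "covering_occurrences v z E" unfolding E_def by (rule X.covering_expected[OF z(1) v(1,2)])
  have z_v: "z (p + k) = v ! nat k" if "p \<in> E" "0 \<le> k" "k < int (length v)" for p k
  proof -
    have "z (p + int (nat k)) = v ! nat k"
      using expected_in_F(1)[OF E v(1) that(1)] that(2,3) unfolding occurs_at_def
      by (meson nat_less_iff)
    then show ?thesis using that(2) by simp
  qed
  have E_F: "p + s \<in> F" if p: "p \<in> E" for p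
  proof -
    have "expected_at w (\<phi> z) (p + s) = expected_at w (\<phi> z) s"
    \<comment> \<open>Both windows lie in a copy of \<open>v\<close>: the one that starts at
      \<open>p\<close>, and the one that starts at \<open>0\<close>, because \<open>v\<close> is a
      prefix of \<open>V\<close>.\<close>
    proof (rule R[OF z(1) z(1)])
      fix i assume i: "\<bar>i\<bar> \<le> int R"
      then have si: "0 \<le> s + i" "s + i < int (length v)" using s_ge v_long by linarith+
      have "z (p + s + i) = v ! nat (s + i)" using z_v[OF p si] by (simp add: add.assoc)
      also have "\<dots> = V !! nat (s + i)"
        using built_from_prefix[OF v(2) v_ne, of "nat (s + i)"] si by (simp add: nat_less_iff)
      also have "\<dots> = z (s + i)" using z(2)[of "nat (s + i)"] si(1) by simp
      finally show "z (p + s + i) = z (s + i)" .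
    qed
    then show ?thesis using s(1) by (simp add: F_def y_def)
  qed
  have E_unbounded: "\<exists>k\<ge>N. k \<in> E" for N
  proof -
    obtain j where j: "j \<ge> nat (N + int (length v))" "\<not> V !! j"
      using rank1_word_zeros_unbounded[OF X.rank1] by blast
    then have "\<not> z (int j)" using z(2) by simp
    then obtain k where "k \<in> E" "int j < k + int (length v)"
      using E unfolding covering_occurrences_def by blast
    then show ?thesis using j(1) by (intro exI[of _ k]) auto
  qed
  have F_unbounded: "\<exists>k\<ge>N. k \<in> F" for N
  proof -
    obtain k where "k \<ge> N - s" "k \<in> E" using E_unbounded by blast
    then show ?thesis using E_F by (intro exI[of _ "k + s"]) auto
  qed
  obtain p0 where p0: "p0 \<in> E" using E_unbounded by blast
  obtain p :: "nat \<Rightarrow> int" where p: "p 0 = p0" "range p = {k \<in> E. p0 \<le> k}" "strict_mono p"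
    "\<And>n. p n + int (length v) \<le> p (Suc n)" "\<And>n. occurs_at v z (p n)"
    "\<And>n j. p n + int (length v) \<le> j \<Longrightarrow> j < p (Suc n) \<Longrightarrow> z j"
    by (rule covering_enumeration[OF E v(1) p0 E_unbounded], rule that)
  obtain f :: "nat \<Rightarrow> int" where f: "f 0 = p0 + s" "range f = {k \<in> F. p0 + s \<le> k}" "strict_mono f"
    "\<And>n. f n + int (length w) \<le> f (Suc n)"
    "\<And>n. occurs_at w y (f n)"
    "\<And>n j. f n + int (length w) \<le> j \<Longrightarrow> j < f (Suc n) \<Longrightarrow> y j"
    by (rule covering_enumeration[OF F w(1) E_F[OF p0] F_unbounded], rule that)
  have p_E: "p t \<in> E" for t using p(2) by blast
  have "p t + s \<in> range f" for t
  proof -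
    have "p0 \<le> p t" using p(2) by blast
    then show ?thesis using E_F[OF p_E[of t]] f(2) by simp
  qed
  then have "\<forall>t. \<exists>n. f n = p t + s" by (metis rangeE)
  then obtain \<iota> where \<iota>: "\<And>t. f (\<iota> t) = p t + s" by metis

  text \<open>Near an expected v in z, the word y is determined by v except within distance r of its
    ends; within a long run of ones in z, it consists of ones.\<close>

  interpret w_blocks y w f \<iota> "int (length v) - int r - s" "s - int r" "2 * int r"
  proof
    show "w \<in> words_F" by (rule w(1))
    show "f n + int (length w) \<le> f (Suc n)" for n by (rule f(4))
    show "occurs_at w y (f n)" for n by (rule f(5))
    show "y j" if "f n + int (length w) \<le> j" "j < f (Suc n)" for n j by (rule f(6)[OF that])
    have "f (\<iota> 0) = f 0" using \<iota> p(1) f(1) by simp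
    then show "\<iota> 0 = 0" using strict_mono_eq[OF f(3)] by blast
    have "f (\<iota> t) < f (\<iota> (Suc t))" for t using \<iota> p(3) by (simp add: strict_mono_def)
    then show "\<iota> t < \<iota> (Suc t)" for t using strict_mono_less[OF f(3)] by blast
    show "0 \<le> int (length v) - int r - s" "0 \<le> s - int r" "0 \<le> 2 * int r" using v_long s_ge by auto
    show "y (f (\<iota> t) + k) = y (f (\<iota> t') + k)" if k: "0 \<le> k" "k < int (length v) - int r - s" for t t' k
      unfolding y_def \<iota>
    proof (rule r[OF z(1) z(1)])
      fix i assume i: "\<bar>i\<bar> \<le> int r"
      then have "0 \<le> s + k + i" "s + k + i < int (length v)" using k s_ge by linarith+
      then have "z (p t + (s + k + i)) = v ! nat (s + k + i)" for t using z_v[OF p_E] by blast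
      then show "z (p t + s + k + i) = z (p t' + s + k + i)" by (simp add: add.assoc)
    qed
    show "y (f (\<iota> (Suc t)) - k) = y (f (\<iota> (Suc t')) - k)" if k: "0 < k" "k \<le> s - int r" for t t' k
      unfolding y_def \<iota>
    proof (rule r[OF z(1) z(1)])
      fix i assume i: "\<bar>i\<bar> \<le> int r"
      then have "0 \<le> s - k + i" "s - k + i < int (length v)" using k v_long by linarith+
      then have "z (p t + (s - k + i)) = v ! nat (s - k + i)" for t using z_v[OF p_E] by blast
      then show "z (p (Suc t) + s - k + i) = z (p (Suc t') + s - k + i)" by (simp add: algebra_simps)
    qed
    \<comment> \<open>The undetermined stretch runs from \<open>r\<close> before the end of one
      \<open>v\<close> to \<open>r\<close> after the start of the next. It has length at least
      \<open>2 * r\<close>, with equality when the two copies of \<open>v\<close> are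
      adjacent.\<close>
    show "f (\<iota> t) + (int (length v) - int r - s) + 2 * int r \<le> f (\<iota> (Suc t)) - (s - int r)" for t
      using p(4)[of t] by (simp add: \<iota>)
    show "y j" if "f (\<iota> t) + (int (length v) - int r - s) + 2 * int r \<le> j"
        "j < f (\<iota> (Suc t)) - (s - int r) - 2 * int r" for t j
      unfolding y_def
    proof (rule r_ones[OF z(1)])
      fix i assume "\<bar>i\<bar> \<le> int r"
      then have "p t + int (length v) \<le> j + i" "j + i < p (Suc t)" using that by (auto simp: \<iota>)
      then show "z (j + i)" by (rule p(6))
    qed
    show "2 * (2 * int r) < int (length (filter Not w))" using w(3) by linarith
  qed

  obtain U C where U: "U \<in> words_F"
    "\<And>t. occurs_at U y (f (\<iota> (Suc t)) - C)"
    "\<And>t. f (\<iota> (Suc t)) - C + int (length U) \<le> f (\<iota> (Suc (Suc t))) - C"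
    "\<And>t i. f (\<iota> (Suc t)) - C + int (length U) \<le> i \<Longrightarrow> i < f (\<iota> (Suc (Suc t))) - C \<Longrightarrow> y i"
    using rotated_blocks by metis
  define G where "G t = f (\<iota> (Suc t)) - C" for t
  have G: "G t = p (Suc t) + (s - C)" for t by (simp add: G_def \<iota>)
  have G_range: "k \<in> range G \<longleftrightarrow> expected_at v z (k - (s - C))" if k: "G 0 \<le> k" for k
  proof
    assume "k \<in> range G"
    then obtain t where "k = G t" by blast
    then show "expected_at v z (k - (s - C))" using p_E[of "Suc t"] by (simp add: G E_def)
  next
    assume "expected_at v z (k - (s - C))"
    moreover have "p 0 < p 1" using p(3) by (simp add: strict_mono_def)
    ultimately have "k - (s - C) \<in> range p" using k p(1,2) by (simp add: G E_def)
    then obtain t where t: "k - (s - C) = p t" by blast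
    \<comment> \<open>\<open>G\<close> starts at block \<open>1\<close>, since the rotated words are
      located by the ends of the original blocks.\<close>
    then have "t \<noteq> 0" using k \<open>p 0 < p 1\<close> by (auto simp: G intro: ccontr)
    then obtain t' where "t = Suc t'" by (cases t) auto
    then have "k = G t'" using t by (simp add: G)
    then show "k \<in> range G" by blast
  qed
  \<comment> \<open>The margin \<open>length U\<close> keeps all positions inspected at
    \<open>i\<close> to the right of \<open>G 0\<close>, where \<open>range G\<close> and the
    displaced expected occurrences of \<open>v\<close> coincide.\<close>
  have "covers_at U y {k. expected_at v z (k - (s - C))} i" if i: "G 0 + int (length U) \<le> i" for i
  proof -
    have "covers_at U y (range G) i"
      by (rule covers_at_range) (use U i in \<open>auto simp: G_def words_F_def\<close>)
    moreover have "covers_at U y (range G) i \<longleftrightarrow> covers_at U y {k. expected_at v z (k - (s - C))} i"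
    proof (rule covers_at_cong)
      fix l assume "\<bar>l\<bar> \<le> int (length U)"
      then have "G 0 \<le> i + l" using i by linarith
      then show "i + l \<in> range G \<longleftrightarrow> i + l \<in> {k. expected_at v z (k - (s - C))}"
        by (simp add: G_range)
    qed simp
    ultimately show ?thesis by simp
  qed
  then show thesis using that[of v U "G 0 + int (length U)" "s - C"] v U(1) by (simp add: y_def)
qed

lemma topological_isomorphism_comp_shift_power:
  "topological_isomorphism X Y (\<phi> \<circ> shift_power n)"
proof -
  obtain \<psi> where \<psi>: "homeomorphism X Y \<phi> \<psi>" using iso by (auto simp: topological_isomorphism_def)
  have cont: "continuous_on X (shift_power n)" for n
    by (rule continuous_on_coordinatewise_then_product)
      (simp add: shift_power_apply continuous_on_subset[OF continuous_on_product_coordinates])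
  have "homeomorphism X X (shift_power n) (shift_power (- n))"
    by (intro homeomorphismI cont)
      (auto simp: shift_power_shift_power shift_power_0 shift_power_rank1_system)
  from homeomorphism_compose[OF this \<psi>]
  have "\<exists>\<psi>. homeomorphism X Y (\<phi> \<circ> shift_power n) \<psi>" by blast
  moreover have "(\<phi> \<circ> shift_power n) (shift x) = shift ((\<phi> \<circ> shift_power n) x)" if "x \<in> X" for x
    using that by (simp add: shift_eq_shift_power shift_power_shift_power \<phi>_shift_power add.commute)
  ultimately show ?thesis by (simp add: topological_isomorphism_def)
qed

lemma stable_shift: "\<exists>i. stable_isomorphism X Y (\<phi> \<circ> shift_power i)"
proof -
  obtain z where z: "z \<in> X" "\<And>n. z (int n) = V !! n"
    "\<And>x M N. x \<in> X \<Longrightarrow> \<exists>n\<ge>N. \<forall>i. \<bar>i\<bar> \<le> M \<longrightarrow> x i = z (n + i)"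
    using rank1_system_transitive_point[OF X.rank1] by metis
  obtain v U c N where vU: "v \<in> words_F" "built_from V v" "U \<in> words_F"
    "\<And>i. N \<le> i \<Longrightarrow> covers_at U (\<phi> z) {k. expected_at v z (k - c)} i"
    using transitive_covering[OF z] by metis
  have "biinf_built_from x v \<and> biinf_built_from ((\<phi> \<circ> shift_power c) x) U \<and>
      (\<forall>k. expected_at v x k \<longleftrightarrow> expected_at U ((\<phi> \<circ> shift_power c) x) k)" if x: "x \<in> X" for x
  proof -
    have cx: "shift_power c x \<in> X" by (rule shift_power_rank1_system[OF x])
    have "covering_occurrences U (\<phi> (shift_power c x)) {k. expected_at v (shift_power c x) (k - c)}"
      by (rule covering_transfer[OF vU(1,2) z(1,3) vU(4) cx])
    \<comment> \<open>Shifting by \<open>c\<close> cancels the fixed distance between the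
      occurrences of \<open>v\<close> and those of \<open>U\<close>.\<close>
    then have cov: "covering_occurrences U (\<phi> (shift_power c x)) {k. expected_at v x k}"
      by (simp add: expected_at_shift_power)
    show ?thesis
      using biinf_built_from_rank1_system[OF x vU(2,1)] cov
        Y.expected_at_iff[OF \<phi>_mem[OF cx] vU(3) cov]
      by (auto simp: biinf_built_from_def)
  qed
  then have "stable_isomorphism X Y (\<phi> \<circ> shift_power c)"
    using topological_isomorphism_comp_shift_power vU(1,3) unfolding stable_isomorphism_def by blast
  then show ?thesis by blast
qed

end

theorem theorem1p1:
  fixes X Y :: "(int \<Rightarrow> bool) set" and \<phi> :: "(int \<Rightarrow> bool) \<Rightarrow> (int \<Rightarrow> bool)"
  assumes "nondegenerate_rank1_system X"
    and "nondegenerate_rank1_system Y"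
    and "topological_isomorphism X Y \<phi>"
  shows "\<exists>i::int. stable_isomorphism X Y (\<phi> \<circ> shift_power i)"
proof -
  obtain V W where VW: "rank1_word V" "\<not> degenerate V" "X = rank1_system V"
    "rank1_word W" "\<not> degenerate W" "Y = rank1_system W"
    using assms(1,2) unfolding nondegenerate_rank1_system_def by metis
  interpret rank1_isomorphism V W \<phi>
    using VW assms(3) by unfold_locales auto
  show ?thesis using stable_shift VW(3,6) by simp
qed

end
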